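(* For every $R$-module $N$, the module scheme $\mathcal N^*$ is a projective $\mathcal R$-module (i.e. a projective object in the category of $\mathcal R$-modules) and a left-exact functor.
   Context: $R$ is an associative ring with unit; "$R$-module" means left $R$-module. An $\mathcal R$-module (resp. right $\mathcal R$-module) is a covariant additive functor from the category of left (resp. right) $R$-modules to the category of abelian groups; morphisms are natural transformations, and exactness of sequences of $\mathcal R$-modules is objectwise. For an $R$-module $N$, let $\mathcal N$ be the quasi-coherent right $\mathcal R$-module $\mathcal N(S)=S\otimes_RN$ ($S$ a right $R$-module). The module scheme associated with $N$ is the $\mathcal R$-module $\mathcal N^*$ defined by $\mathcal N^*(S)=\mathrm{Hom}_{\mathcal R}(\mathcal N,\mathcal S)$ for every left $R$-module $S$, where $\mathcal S$ is the quasi-coherent right $\mathcal R$-module associated with $S$ and $\mathrm{Hom}_{\mathcal R}$ denotes natural transformations; it is identified with $\mathrm{Hom}_R(N,-)$. *)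

theory Defs
  imports "HOL-Algebra.Algebra"
begin

text \<open>
  The type variable \<open>'u\<close> plays the role of a universe: the ring \<open>R\<close> and all left and right
  \<open>R\<close>-modules have their carriers in \<open>'u\<close>. Morphisms are extensional functions (they are
  \<open>undefined\<close> outside the carrier of their source), so that equality of morphisms is equality
  on the source. The record fields \<open>mult\<close> and \<open>one\<close> that the type of modules inherits from
  the type of rings carry no meaning.

  \<^const>\<open>module\<close> cannot be used, since it requires a commutative ring of scalars.
\<close>

locale left_module = R?: ring R + M?: abelian_group M
  for R :: "('a, 'r) ring_scheme" (structure) and M :: "('a, 'b, 'm) module_scheme" (structure) +
  assumes smult_closed: "\<lbrakk>a \<in> carrier R; x \<in> carrier M\<rbrakk> \<Longrightarrow> a \<odot>\<^bsub>M\<^esub> x \<in> carrier M"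
    and smult_l_distr: "\<lbrakk>a \<in> carrier R; b \<in> carrier R; x \<in> carrier M\<rbrakk> \<Longrightarrow>
      (a \<oplus>\<^bsub>R\<^esub> b) \<odot>\<^bsub>M\<^esub> x = a \<odot>\<^bsub>M\<^esub> x \<oplus>\<^bsub>M\<^esub> b \<odot>\<^bsub>M\<^esub> x"
    and smult_r_distr: "\<lbrakk>a \<in> carrier R; x \<in> carrier M; y \<in> carrier M\<rbrakk> \<Longrightarrow>
      a \<odot>\<^bsub>M\<^esub> (x \<oplus>\<^bsub>M\<^esub> y) = a \<odot>\<^bsub>M\<^esub> x \<oplus>\<^bsub>M\<^esub> a \<odot>\<^bsub>M\<^esub> y"
    and smult_assoc: "\<lbrakk>a \<in> carrier R; b \<in> carrier R; x \<in> carrier M\<rbrakk> \<Longrightarrow>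
      (a \<otimes>\<^bsub>R\<^esub> b) \<odot>\<^bsub>M\<^esub> x = a \<odot>\<^bsub>M\<^esub> (b \<odot>\<^bsub>M\<^esub> x)"
    and smult_one: "x \<in> carrier M \<Longrightarrow> \<one>\<^bsub>R\<^esub> \<odot>\<^bsub>M\<^esub> x = x"

text \<open>
  A right \<open>R\<close>-module is a left module over the opposite ring; the right action
  \<open>x \<cdot> r\<close> is written \<open>r \<odot> x\<close>.
\<close>

definition opp_ring :: "'a ring \<Rightarrow> 'a ring" where
  "opp_ring R = R\<lparr>monoid.mult := (\<lambda>a b. b \<otimes>\<^bsub>R\<^esub> a)\<rparr>"

abbreviation right_module :: "'a ring \<Rightarrow> ('a, 'b) module \<Rightarrow> bool" where
  "right_module R M \<equiv> left_module (opp_ring R) M"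

definition lin_maps :: "'a ring \<Rightarrow> ('a, 'b) module \<Rightarrow> ('a, 'c) module \<Rightarrow> ('b \<Rightarrow> 'c) set" where
  "lin_maps R A B = {f \<in> carrier A \<rightarrow>\<^sub>E carrier B.
     (\<forall>x\<in>carrier A. \<forall>y\<in>carrier A. f (x \<oplus>\<^bsub>A\<^esub> y) = f x \<oplus>\<^bsub>B\<^esub> f y) \<and>
     (\<forall>r\<in>carrier R. \<forall>x\<in>carrier A. f (r \<odot>\<^bsub>A\<^esub> x) = r \<odot>\<^bsub>B\<^esub> f x)}"

definition ab_homs :: "'v monoid \<Rightarrow> 'w monoid \<Rightarrow> ('v \<Rightarrow> 'w) set" where
  "ab_homs G H = hom G H \<inter> extensional (carrier G)"


text \<open>
  Additive functors from left \<open>R\<close>-modules to abelian groups (written multiplicatively).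
  \<open>fmap F A B f\<close> is the value at the morphism \<open>f\<close> from \<open>A\<close> to \<open>B\<close>; source and target are
  arguments because a function does not determine them.
  Functors on right \<open>R\<close>-modules are obtained with \<^const>\<open>opp_ring\<close> in place of the ring.
\<close>

record ('u, 'v) mod_functor =
  fobj :: "('u, 'u) module \<Rightarrow> 'v monoid"
  fmap :: "('u, 'u) module \<Rightarrow> ('u, 'u) module \<Rightarrow> ('u \<Rightarrow> 'u) \<Rightarrow> 'v \<Rightarrow> 'v"

definition additive_functor :: "'u ring \<Rightarrow> ('u, 'v) mod_functor \<Rightarrow> bool" where
  "additive_functor R F \<longleftrightarrow>
     (\<forall>A. left_module R A \<longrightarrow> comm_group (fobj F A)) \<and>
     (\<forall>A B f. left_module R A \<longrightarrow> left_module R B \<longrightarrow> f \<in> lin_maps R A B \<longrightarrow>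
        fmap F A B f \<in> ab_homs (fobj F A) (fobj F B)) \<and>
     (\<forall>A. left_module R A \<longrightarrow>
        fmap F A A (\<lambda>x\<in>carrier A. x) = (\<lambda>x\<in>carrier (fobj F A). x)) \<and>
     (\<forall>A B C f g. left_module R A \<longrightarrow> left_module R B \<longrightarrow> left_module R C \<longrightarrow>
        f \<in> lin_maps R A B \<longrightarrow> g \<in> lin_maps R B C \<longrightarrow>
        fmap F A C (compose (carrier A) g f) =
          compose (carrier (fobj F A)) (fmap F B C g) (fmap F A B f)) \<and>
     (\<forall>A B f g. left_module R A \<longrightarrow> left_module R B \<longrightarrow>
        f \<in> lin_maps R A B \<longrightarrow> g \<in> lin_maps R A B \<longrightarrow>
        fmap F A B (\<lambda>x\<in>carrier A. f x \<oplus>\<^bsub>B\<^esub> g x) =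
          (\<lambda>x\<in>carrier (fobj F A). fmap F A B f x \<otimes>\<^bsub>fobj F B\<^esub> fmap F A B g x))"

definition nat_trans ::
  "'u ring \<Rightarrow> ('u, 'v) mod_functor \<Rightarrow> ('u, 'w) mod_functor \<Rightarrow> (('u, 'u) module \<Rightarrow> 'v \<Rightarrow> 'w) set"
  where
  "nat_trans R F G = {t \<in> extensional {A. left_module R A}.
     (\<forall>A. left_module R A \<longrightarrow> t A \<in> ab_homs (fobj F A) (fobj G A)) \<and>
     (\<forall>A B f. left_module R A \<longrightarrow> left_module R B \<longrightarrow> f \<in> lin_maps R A B \<longrightarrow>
        compose (carrier (fobj F A)) (fmap G A B f) (t A) =
        compose (carrier (fobj F A)) (t B) (fmap F A B f))}"

text \<open>The composite of \<open>t\<close> (with source \<open>F\<close>) followed by \<open>u\<close>.\<close>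

definition nat_comp ::
  "'u ring \<Rightarrow> ('u, 'v) mod_functor \<Rightarrow> (('u, 'u) module \<Rightarrow> 'w \<Rightarrow> 'x) \<Rightarrow>
   (('u, 'u) module \<Rightarrow> 'v \<Rightarrow> 'w) \<Rightarrow> ('u, 'u) module \<Rightarrow> 'v \<Rightarrow> 'x" where
  "nat_comp R F u t =
     (\<lambda>A \<in> {A. left_module R A}. compose (carrier (fobj F A)) (u A) (t A))"

definition nat_trans_group ::
  "'u ring \<Rightarrow> ('u, 'v) mod_functor \<Rightarrow> ('u, 'w) mod_functor \<Rightarrow> (('u, 'u) module \<Rightarrow> 'v \<Rightarrow> 'w) monoid"
  where
  "nat_trans_group R F G =
     \<lparr>carrier = nat_trans R F G,
      monoid.mult = (\<lambda>t u. \<lambda>A \<in> {A. left_module R A}. \<lambda>x \<in> carrier (fobj F A). t A x \<otimes>\<^bsub>fobj G A\<^esub> u A x),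
      one = (\<lambda>A \<in> {A. left_module R A}. \<lambda>x \<in> carrier (fobj F A). \<one>\<^bsub>fobj G A\<^esub>)\<rparr>"


text \<open>
  The tensor product \<open>S \<otimes>\<^sub>R N\<close> of a right module \<open>S\<close> and a left module \<open>N\<close>: the free abelian
  group on \<open>S \<times> N\<close> modulo biadditivity and \<open>(s \<cdot> r) \<otimes> n = s \<otimes> (r \<cdot> n)\<close>. The library's free
  abelian groups are multiplicative groups whose operation is the addition of finitely
  supported functions.
\<close>

definition tensor_rels ::
  "'a ring \<Rightarrow> ('a, 'b) module \<Rightarrow> ('a, 'c) module \<Rightarrow> (('b \<times> 'c) \<Rightarrow>\<^sub>0 int) set" where
  "tensor_rels R S N = generate (free_Abelian_group (carrier S \<times> carrier N))
     ({frag_of (s \<oplus>\<^bsub>S\<^esub> s', n) - frag_of (s, n) - frag_of (s', n) | s s' n.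
         s \<in> carrier S \<and> s' \<in> carrier S \<and> n \<in> carrier N} \<union>
      {frag_of (s, n \<oplus>\<^bsub>N\<^esub> n') - frag_of (s, n) - frag_of (s, n') | s n n'.
         s \<in> carrier S \<and> n \<in> carrier N \<and> n' \<in> carrier N} \<union>
      {frag_of (r \<odot>\<^bsub>S\<^esub> s, n) - frag_of (s, r \<odot>\<^bsub>N\<^esub> n) | r s n.
         r \<in> carrier R \<and> s \<in> carrier S \<and> n \<in> carrier N})"

definition tensor ::
  "'a ring \<Rightarrow> ('a, 'b) module \<Rightarrow> ('a, 'c) module \<Rightarrow> (('b \<times> 'c) \<Rightarrow>\<^sub>0 int) set monoid" where
  "tensor R S N = free_Abelian_group (carrier S \<times> carrier N) Mod tensor_rels R S N"

text \<open>
  \<open>g \<otimes> f\<close>, from \<open>S \<otimes>\<^sub>R N\<close> to \<open>S' \<otimes>\<^sub>R N'\<close>: the class of \<open>x\<close> is sent to the class of the image of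
  \<open>x\<close> under the additive extension of \<open>(s, n) \<mapsto> (g s, f n)\<close>.
\<close>

definition tensor_map ::
  "'a ring \<Rightarrow> ('a, 'b) module \<Rightarrow> ('a, 'c) module \<Rightarrow> ('a, 'd) module \<Rightarrow> ('a, 'e) module \<Rightarrow>
   ('b \<Rightarrow> 'd) \<Rightarrow> ('c \<Rightarrow> 'e) \<Rightarrow> (('b \<times> 'c) \<Rightarrow>\<^sub>0 int) set \<Rightarrow> (('d \<times> 'e) \<Rightarrow>\<^sub>0 int) set" where
  "tensor_map R S N S' N' g f = (\<lambda>Z \<in> carrier (tensor R S N).
     the_elem ((\<lambda>x. tensor_rels R S' N' #>\<^bsub>free_Abelian_group (carrier S' \<times> carrier N')\<^esub>
       frag_extend (\<lambda>(s, n). frag_of (g s, f n)) x) ` Z))"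


text \<open>
  The quasi-coherent right module \<open>\<N>\<close>, \<open>\<N>(S) = S \<otimes>\<^sub>R N\<close>, a functor on right \<open>R\<close>-modules, and the
  morphism of quasi-coherent modules induced by a linear map \<open>f\<close> from \<open>N\<close> to \<open>N'\<close>.
\<close>

definition quasi_coherent ::
  "'u ring \<Rightarrow> ('u, 'u) module \<Rightarrow> ('u, (('u \<times> 'u) \<Rightarrow>\<^sub>0 int) set) mod_functor" where
  "quasi_coherent R N =
     \<lparr>fobj = (\<lambda>S. tensor R S N),
      fmap = (\<lambda>S S' g. tensor_map R S N S' N g (\<lambda>n\<in>carrier N. n))\<rparr>"

definition quasi_coherent_map ::
  "'u ring \<Rightarrow> ('u, 'u) module \<Rightarrow> ('u, 'u) module \<Rightarrow> ('u \<Rightarrow> 'u) \<Rightarrow>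
   ('u, 'u) module \<Rightarrow> (('u \<times> 'u) \<Rightarrow>\<^sub>0 int) set \<Rightarrow> (('u \<times> 'u) \<Rightarrow>\<^sub>0 int) set" where
  "quasi_coherent_map R N N' f =
     (\<lambda>S \<in> {S. right_module R S}. tensor_map R S N S N' (\<lambda>s\<in>carrier S. s) f)"

text \<open>The module scheme \<open>\<N>\<^sup>*\<close>, acting on morphisms by postcomposition.\<close>

definition module_scheme ::
  "'u ring \<Rightarrow> ('u, 'u) module \<Rightarrow>
   ('u, ('u, 'u) module \<Rightarrow> (('u \<times> 'u) \<Rightarrow>\<^sub>0 int) set \<Rightarrow> (('u \<times> 'u) \<Rightarrow>\<^sub>0 int) set) mod_functor" where
  "module_scheme R N =
     \<lparr>fobj = (\<lambda>S. nat_trans_group (opp_ring R) (quasi_coherent R N) (quasi_coherent R S)),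
      fmap = (\<lambda>S S' f. \<lambda>t \<in> nat_trans (opp_ring R) (quasi_coherent R N) (quasi_coherent R S).
        nat_comp (opp_ring R) (quasi_coherent R N) (quasi_coherent_map R S S' f) t)\<rparr>"


text \<open>
  Epimorphisms are right-cancellable morphisms. The test functors \<open>H\<close> take values in groups
  on the same type as those of \<open>G\<close>; this includes (a copy of) the cokernel of \<open>p\<close>, so further
  value types would not change the notion.
\<close>

definition epi_trans ::
  "'u ring \<Rightarrow> ('u, 'v) mod_functor \<Rightarrow> ('u, 'w) mod_functor \<Rightarrow> (('u, 'u) module \<Rightarrow> 'v \<Rightarrow> 'w) \<Rightarrow> bool"
  where
  "epi_trans R F G p \<longleftrightarrow> p \<in> nat_trans R F G \<and>
     (\<forall>(H :: ('u, 'w) mod_functor) u v. additive_functor R H \<longrightarrow>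
        u \<in> nat_trans R G H \<longrightarrow> v \<in> nat_trans R G H \<longrightarrow>
        nat_comp R F u p = nat_comp R F v p \<longrightarrow> u = v)"

text \<open>
  The type arguments are the value types of the functors against which \<open>P\<close> is tested;
  projectivity means this property for all \<open>'v\<close> and \<open>'w\<close>.
\<close>

definition projective_functor ::
  "'v itself \<Rightarrow> 'w itself \<Rightarrow> 'u ring \<Rightarrow> ('u, 'p) mod_functor \<Rightarrow> bool" where
  "projective_functor _ _ R P \<longleftrightarrow> additive_functor R P \<and>
     (\<forall>(F :: ('u, 'v) mod_functor) (G :: ('u, 'w) mod_functor) p q.
        additive_functor R F \<longrightarrow> additive_functor R G \<longrightarrow>
        epi_trans R F G p \<longrightarrow> q \<in> nat_trans R P G \<longrightarrow>
        (\<exists>l \<in> nat_trans R P F. nat_comp R P p l = q))"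

text \<open>
  \<^const>\<open>add_monoid\<close> would keep the scalar multiplication as a record extension, whereas
  \<^const>\<open>exact_seq\<close> expects plain monoid records.
\<close>

definition add_group :: "('a, 'b) module \<Rightarrow> 'b monoid" where
  "add_group M = \<lparr>carrier = carrier M, monoid.mult = (\<oplus>\<^bsub>M\<^esub>), one = \<zero>\<^bsub>M\<^esub>\<rparr>"

text \<open>\<open>F\<close> sends exact sequences \<open>0 \<rightarrow> A \<rightarrow> B \<rightarrow> C\<close> to exact sequences.\<close>

definition left_exact_functor :: "'u ring \<Rightarrow> ('u, 'v) mod_functor \<Rightarrow> bool" where
  "left_exact_functor R F \<longleftrightarrow> additive_functor R F \<and>
     (\<forall>A B C f g. left_module R A \<longrightarrow> left_module R B \<longrightarrow> left_module R C \<longrightarrow>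
        f \<in> lin_maps R A B \<longrightarrow> g \<in> lin_maps R B C \<longrightarrow>
        inj_on f (carrier A) \<longrightarrow>
        exact_seq ([add_group C, add_group B, add_group A], [g, f]) \<longrightarrow>
        inj_on (fmap F A B f) (carrier (fobj F A)) \<and>
        exact_seq ([fobj F C, fobj F B, fobj F A], [fmap F B C g, fmap F A B f]))"

end

theory Submission
  imports Defs
begin

text \<open>
  The module scheme of \<open>N\<close> is isomorphic to the functor \<open>Hom\<^sub>R(N, -)\<close>, and this functor is left
  exact and, among additive functors, projective.

  For the isomorphism, a linear map \<open>f\<close> from \<open>N\<close> to \<open>A\<close> gives the natural transformation
  \<open>s \<otimes> n \<mapsto> s \<otimes> f(n)\<close>. Every natural transformation \<open>t\<close> from the quasi-coherent module of \<open>N\<close> to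
  that of \<open>A\<close> has this form for exactly one \<open>f\<close>: at the right module \<open>R\<close> it is an additive map
  from \<open>R \<otimes>\<^sub>R N = N\<close> to \<open>R \<otimes>\<^sub>R A = A\<close>, and naturality with respect to the maps \<open>r \<mapsto> s r\<close> from
  \<open>R\<close> to a right module \<open>S\<close> shows both that this map is linear and that it determines \<open>t\<close>
  (\<open>quasi_coherent_map_inj\<close>, \<open>quasi_coherent_map_surj\<close>).

  For projectivity, the Yoneda lemma identifies the morphisms from \<open>Hom\<^sub>R(N, -)\<close> to an additive
  functor \<open>F\<close> with the elements of \<open>F(N)\<close>. Lifting a morphism along \<open>p\<close> from \<open>F\<close> to \<open>G\<close> is thus
  lifting an element of \<open>G(N)\<close> to \<open>F(N)\<close>, which is possible because an epimorphism is surjective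
  at every module (\<open>epi_trans_surj\<close>): its cokernel, taken module by module, is again an additive
  functor, and the projection to it must be zero.

  Both properties pass along the isomorphism (\<open>projective_functor_retract\<close>,
  \<open>left_exact_functor_natural_iso\<close>).
\<close>

section \<open>Linear maps\<close>

lemma lin_mapsD:
  assumes "f \<in> lin_maps R A B"
  shows lin_maps_closed: "x \<in> carrier A \<Longrightarrow> f x \<in> carrier B"
    and lin_maps_add: "\<lbrakk>x \<in> carrier A; y \<in> carrier A\<rbrakk> \<Longrightarrow> f (x \<oplus>\<^bsub>A\<^esub> y) = f x \<oplus>\<^bsub>B\<^esub> f y"
    and lin_maps_smult: "\<lbrakk>r \<in> carrier R; x \<in> carrier A\<rbrakk> \<Longrightarrow> f (r \<odot>\<^bsub>A\<^esub> x) = r \<odot>\<^bsub>B\<^esub> f x"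
    and lin_maps_extensional: "f \<in> extensional (carrier A)"
  using assms by (auto simp: lin_maps_def PiE_iff)

lemma lin_mapsI:
  assumes "\<And>x. x \<in> carrier A \<Longrightarrow> f x \<in> carrier B"
    and "\<And>x y. \<lbrakk>x \<in> carrier A; y \<in> carrier A\<rbrakk> \<Longrightarrow> f (x \<oplus>\<^bsub>A\<^esub> y) = f x \<oplus>\<^bsub>B\<^esub> f y"
    and "\<And>r x. \<lbrakk>r \<in> carrier R; x \<in> carrier A\<rbrakk> \<Longrightarrow> f (r \<odot>\<^bsub>A\<^esub> x) = r \<odot>\<^bsub>B\<^esub> f x"
    and "f \<in> extensional (carrier A)"
  shows "f \<in> lin_maps R A B"
  using assms by (auto simp: lin_maps_def PiE_iff)

lemma left_module_smult_zero:
  assumes "left_module R A" "r \<in> carrier R"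
  shows "r \<odot>\<^bsub>A\<^esub> \<zero>\<^bsub>A\<^esub> = \<zero>\<^bsub>A\<^esub>"
proof -
  interpret A: left_module R A by fact
  have "r \<odot>\<^bsub>A\<^esub> \<zero>\<^bsub>A\<^esub> \<oplus>\<^bsub>A\<^esub> r \<odot>\<^bsub>A\<^esub> \<zero>\<^bsub>A\<^esub> = r \<odot>\<^bsub>A\<^esub> \<zero>\<^bsub>A\<^esub>"
    using assms(2) by (metis A.smult_r_distr A.M.zero_closed A.M.l_zero)
  then show ?thesis
    using assms(2) A.M.add.l_cancel_one' A.smult_closed by (metis A.M.zero_closed A.M.add.r_cancel_one')
qed

lemma id_lin_map:
  assumes "left_module R A"
  shows "(\<lambda>x\<in>carrier A. x) \<in> lin_maps R A A"
proof -
  interpret A: left_module R A by fact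
  show ?thesis by (rule lin_mapsI) (auto simp: A.smult_closed)
qed

lemma compose_lin_maps:
  assumes "left_module R A" "f \<in> lin_maps R A B" "g \<in> lin_maps R B C"
  shows "compose (carrier A) g f \<in> lin_maps R A C"
proof -
  interpret A: left_module R A by fact
  show ?thesis
    using assms(2,3)
    by (intro lin_mapsI) (auto simp: compose_def lin_mapsD A.smult_closed)
qed

lemma add_lin_maps:
  assumes "left_module R A" "left_module R B" "f \<in> lin_maps R A B" "g \<in> lin_maps R A B"
  shows "(\<lambda>x\<in>carrier A. f x \<oplus>\<^bsub>B\<^esub> g x) \<in> lin_maps R A B"
proof -
  interpret A: left_module R A by fact
  interpret B: left_module R B by fact
  show ?thesis
    using assms(3,4)
    by (intro lin_mapsI)
       (auto simp: lin_mapsD A.smult_closed B.smult_r_distr B.M.add.m_ac)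
qed

lemma zero_lin_map:
  assumes "left_module R A" "left_module R B"
  shows "(\<lambda>x\<in>carrier A. \<zero>\<^bsub>B\<^esub>) \<in> lin_maps R A B"
proof -
  interpret A: left_module R A by fact
  interpret B: left_module R B by fact
  show ?thesis
    by (intro lin_mapsI)
       (auto simp: A.smult_closed left_module_smult_zero[OF assms(2)])
qed

lemma neg_lin_map:
  assumes "left_module R A" "left_module R B" "f \<in> lin_maps R A B"
  shows "(\<lambda>x\<in>carrier A. \<ominus>\<^bsub>B\<^esub> f x) \<in> lin_maps R A B"
proof -
  interpret A: left_module R A by fact
  interpret B: left_module R B by fact
  have "\<ominus>\<^bsub>B\<^esub> (r \<odot>\<^bsub>B\<^esub> y) = r \<odot>\<^bsub>B\<^esub> (\<ominus>\<^bsub>B\<^esub> y)" if ry: "r \<in> carrier R" "y \<in> carrier B" for r y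
  proof (rule B.M.minus_equality)
    have "r \<odot>\<^bsub>B\<^esub> (\<ominus>\<^bsub>B\<^esub> y) \<oplus>\<^bsub>B\<^esub> r \<odot>\<^bsub>B\<^esub> y = r \<odot>\<^bsub>B\<^esub> (\<ominus>\<^bsub>B\<^esub> y \<oplus>\<^bsub>B\<^esub> y)"
      using ry by (simp only: B.smult_r_distr B.M.a_inv_closed)
    also have "\<dots> = \<zero>\<^bsub>B\<^esub>"
      using ry by (simp only: B.M.l_neg left_module_smult_zero[OF assms(2)])
    finally show "r \<odot>\<^bsub>B\<^esub> (\<ominus>\<^bsub>B\<^esub> y) \<oplus>\<^bsub>B\<^esub> r \<odot>\<^bsub>B\<^esub> y = \<zero>\<^bsub>B\<^esub>" .
  qed (use ry in \<open>simp_all add: B.smult_closed\<close>)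
  then show ?thesis
    using assms(3)
    by (intro lin_mapsI) (auto simp: lin_mapsD A.smult_closed B.M.minus_add)
qed

section \<open>Additive functors and natural transformations\<close>

lemma ab_homsD:
  assumes "t \<in> ab_homs G H"
  shows ab_homs_closed: "x \<in> carrier G \<Longrightarrow> t x \<in> carrier H"
    and ab_homs_mult: "\<lbrakk>x \<in> carrier G; y \<in> carrier G\<rbrakk> \<Longrightarrow> t (x \<otimes>\<^bsub>G\<^esub> y) = t x \<otimes>\<^bsub>H\<^esub> t y"
    and ab_homs_extensional: "t \<in> extensional (carrier G)"
    and ab_homs_hom: "t \<in> hom G H"
  using assms by (auto simp: ab_homs_def hom_def)

lemma ab_homsI:
  assumes "\<And>x. x \<in> carrier G \<Longrightarrow> t x \<in> carrier H"
    and "\<And>x y. \<lbrakk>x \<in> carrier G; y \<in> carrier G\<rbrakk> \<Longrightarrow> t (x \<otimes>\<^bsub>G\<^esub> y) = t x \<otimes>\<^bsub>H\<^esub> t y"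
    and "t \<in> extensional (carrier G)"
  shows "t \<in> ab_homs G H"
  using assms by (auto simp: ab_homs_def hom_def)

lemma additive_functorD:
  assumes "additive_functor R F"
  shows functor_comm_group: "left_module R A \<Longrightarrow> comm_group (fobj F A)"
    and functor_group: "left_module R A \<Longrightarrow> group (fobj F A)"
    and functor_map: "\<lbrakk>left_module R A; left_module R B; f \<in> lin_maps R A B\<rbrakk> \<Longrightarrow>
      fmap F A B f \<in> ab_homs (fobj F A) (fobj F B)"
    and functor_id: "\<lbrakk>left_module R A; x \<in> carrier (fobj F A)\<rbrakk> \<Longrightarrow>
      fmap F A A (\<lambda>x\<in>carrier A. x) x = x"
    and functor_comp: "\<lbrakk>left_module R A; left_module R B; left_module R C;
        f \<in> lin_maps R A B; g \<in> lin_maps R B C; x \<in> carrier (fobj F A)\<rbrakk> \<Longrightarrow>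
      fmap F A C (compose (carrier A) g f) x = fmap F B C g (fmap F A B f x)"
    and functor_add: "\<lbrakk>left_module R A; left_module R B;
        f \<in> lin_maps R A B; g \<in> lin_maps R A B; x \<in> carrier (fobj F A)\<rbrakk> \<Longrightarrow>
      fmap F A B (\<lambda>x\<in>carrier A. f x \<oplus>\<^bsub>B\<^esub> g x) x = fmap F A B f x \<otimes>\<^bsub>fobj F B\<^esub> fmap F A B g x"
  using assms comm_group.axioms(2) by (force simp: additive_functor_def compose_def)+

lemma functor_map_closed:
  assumes "additive_functor R F" "left_module R A" "left_module R B" "f \<in> lin_maps R A B"
    and "x \<in> carrier (fobj F A)"
  shows "fmap F A B f x \<in> carrier (fobj F B)"
  by (rule ab_homs_closed[OF functor_map[OF assms(1-4)] assms(5)])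

lemma functor_mult_closed:
  assumes "additive_functor R F" "left_module R A"
    and "x \<in> carrier (fobj F A)" "y \<in> carrier (fobj F A)"
  shows "x \<otimes>\<^bsub>fobj F A\<^esub> y \<in> carrier (fobj F A)"
proof -
  interpret group "fobj F A" by (rule functor_group[OF assms(1,2)])
  show ?thesis using assms(3,4) by (rule m_closed)
qed

lemma additive_functorI:
  fixes F :: "('u, 'v) mod_functor"
  assumes "\<And>A. left_module R A \<Longrightarrow> comm_group (fobj F A)"
    and "\<And>A B f. \<lbrakk>left_module R A; left_module R B; f \<in> lin_maps R A B\<rbrakk> \<Longrightarrow>
      fmap F A B f \<in> ab_homs (fobj F A) (fobj F B)"
    and "\<And>A x. \<lbrakk>left_module R A; x \<in> carrier (fobj F A)\<rbrakk> \<Longrightarrow>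
      fmap F A A (\<lambda>x\<in>carrier A. x) x = x"
    and "\<And>A B C f g x. \<lbrakk>left_module R A; left_module R B; left_module R C;
        f \<in> lin_maps R A B; g \<in> lin_maps R B C; x \<in> carrier (fobj F A)\<rbrakk> \<Longrightarrow>
      fmap F A C (compose (carrier A) g f) x = fmap F B C g (fmap F A B f x)"
    and "\<And>A B f g x. \<lbrakk>left_module R A; left_module R B;
        f \<in> lin_maps R A B; g \<in> lin_maps R A B; x \<in> carrier (fobj F A)\<rbrakk> \<Longrightarrow>
      fmap F A B (\<lambda>x\<in>carrier A. f x \<oplus>\<^bsub>B\<^esub> g x) x = fmap F A B f x \<otimes>\<^bsub>fobj F B\<^esub> fmap F A B g x"
  shows "additive_functor R F"
proof -
  have ext: "fmap F A B f \<in> extensional (carrier (fobj F A))"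
    if "left_module R A" "left_module R B" "f \<in> lin_maps R A B" for A B f
    using assms(2)[OF that] by (rule ab_homs_extensional)
  show ?thesis
    unfolding additive_functor_def
  proof (intro conjI allI impI)
    fix A :: "('u, 'u) module" assume A: "left_module R A"
    show "fmap F A A (\<lambda>x\<in>carrier A. x) = (\<lambda>x\<in>carrier (fobj F A). x)"
      by (rule extensionalityI[OF ext]) (use A assms(3) id_lin_map in auto)
  next
    fix A B C :: "('u, 'u) module" and f g
    assume *: "left_module R A" "left_module R B" "left_module R C"
      "f \<in> lin_maps R A B" "g \<in> lin_maps R B C"
    show "fmap F A C (compose (carrier A) g f) =
      compose (carrier (fobj F A)) (fmap F B C g) (fmap F A B f)"
      by (rule extensionalityI[OF ext compose_extensional])
         (use * assms(4) compose_lin_maps in \<open>auto simp: compose_def\<close>)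
  next
    fix A B :: "('u, 'u) module" and f g
    assume *: "left_module R A" "left_module R B" "f \<in> lin_maps R A B" "g \<in> lin_maps R A B"
    show "fmap F A B (\<lambda>x\<in>carrier A. f x \<oplus>\<^bsub>B\<^esub> g x) =
      (\<lambda>x\<in>carrier (fobj F A). fmap F A B f x \<otimes>\<^bsub>fobj F B\<^esub> fmap F A B g x)"
      by (rule extensionalityI[OF ext restrict_extensional])
         (use * assms(5) add_lin_maps in auto)
  qed (use assms(1,2) in auto)
qed

lemma nat_transD:
  assumes "t \<in> nat_trans R F G"
  shows nat_trans_extensional: "t \<in> extensional {A. left_module R A}"
    and nat_trans_ab_homs: "left_module R A \<Longrightarrow> t A \<in> ab_homs (fobj F A) (fobj G A)"
    and nat_trans_natural: "\<lbrakk>left_module R A; left_module R B; f \<in> lin_maps R A B;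
        x \<in> carrier (fobj F A)\<rbrakk> \<Longrightarrow> fmap G A B f (t A x) = t B (fmap F A B f x)"
proof -
  show "t \<in> extensional {A. left_module R A}"
    and "left_module R A \<Longrightarrow> t A \<in> ab_homs (fobj F A) (fobj G A)"
    using assms by (auto simp: nat_trans_def)
  assume *: "left_module R A" "left_module R B" "f \<in> lin_maps R A B" "x \<in> carrier (fobj F A)"
  then have "compose (carrier (fobj F A)) (fmap G A B f) (t A) =
        compose (carrier (fobj F A)) (t B) (fmap F A B f)"
    using assms by (auto simp: nat_trans_def)
  from fun_cong[OF this, of x] show "fmap G A B f (t A x) = t B (fmap F A B f x)"
    using * by (simp add: compose_def)
qed

lemma nat_transI:
  fixes F :: "('u, 'v) mod_functor"
  assumes "t \<in> extensional {A. left_module R A}"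
    and "\<And>A. left_module R A \<Longrightarrow> t A \<in> ab_homs (fobj F A) (fobj G A)"
    and "\<And>A B f x. \<lbrakk>left_module R A; left_module R B; f \<in> lin_maps R A B;
        x \<in> carrier (fobj F A)\<rbrakk> \<Longrightarrow> fmap G A B f (t A x) = t B (fmap F A B f x)"
  shows "t \<in> nat_trans R F G"
  using assms unfolding nat_trans_def by (auto simp: compose_def fun_eq_iff restrict_def)

lemma nat_trans_eqI:
  fixes F :: "('u, 'v) mod_functor"
  assumes "t \<in> nat_trans R F G" "u \<in> nat_trans R F H"
    and "\<And>A x. \<lbrakk>left_module R A; x \<in> carrier (fobj F A)\<rbrakk> \<Longrightarrow> t A x = u A x"
  shows "t = u"
proof (rule extensionalityI)
  fix A :: "('u, 'u) module" assume "A \<in> {A. left_module R A}"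
  then have "left_module R A" by simp
  then show "t A = u A"
    using assms
    by (intro extensionalityI[where A = "carrier (fobj F A)"])
       (auto dest: nat_trans_ab_homs ab_homs_extensional)
qed (use assms in \<open>auto dest: nat_trans_extensional\<close>)

lemma nat_comp_apply:
  "\<lbrakk>left_module R A; x \<in> carrier (fobj F A)\<rbrakk> \<Longrightarrow> nat_comp R F u t A x = u A (t A x)"
  by (simp add: nat_comp_def compose_def)

text \<open>
  Composition uses only two closure properties of the source \<open>F\<close>, and these are immediate for
  \<^const>\<open>quasi_coherent\<close>.
\<close>

lemma nat_comp_nat_trans:
  fixes F :: "('u, 'v) mod_functor"
  assumes t: "t \<in> nat_trans R F G" and u: "u \<in> nat_trans R G H"
    and map: "\<And>A B f x. \<lbrakk>left_module R A; left_module R B; f \<in> lin_maps R A B;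
      x \<in> carrier (fobj F A)\<rbrakk> \<Longrightarrow> fmap F A B f x \<in> carrier (fobj F B)"
    and clos: "\<And>A x y. \<lbrakk>left_module R A; x \<in> carrier (fobj F A); y \<in> carrier (fobj F A)\<rbrakk> \<Longrightarrow>
      x \<otimes>\<^bsub>fobj F A\<^esub> y \<in> carrier (fobj F A)"
  shows "nat_comp R F u t \<in> nat_trans R F H"
proof (rule nat_transI)
  show "nat_comp R F u t \<in> extensional {A. left_module R A}"
    by (simp add: nat_comp_def)
next
  fix A :: "('u, 'u) module" assume A: "left_module R A"
  note tA = nat_trans_ab_homs[OF t A] and uA = nat_trans_ab_homs[OF u A]
  show "nat_comp R F u t A \<in> ab_homs (fobj F A) (fobj H A)"
    using A tA uA clos[OF A]
    by (intro ab_homsI) (auto simp: nat_comp_def compose_def ab_homsD)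
next
  fix A B :: "('u, 'u) module" and f x
  assume *: "left_module R A" "left_module R B" "f \<in> lin_maps R A B" "x \<in> carrier (fobj F A)"
  have "t A x \<in> carrier (fobj G A)"
    using ab_homs_closed[OF nat_trans_ab_homs[OF t]] * by blast
  then show "fmap H A B f (nat_comp R F u t A x) = nat_comp R F u t B (fmap F A B f x)"
    using * by (simp add: nat_comp_apply map nat_trans_natural[OF t] nat_trans_natural[OF u])
qed

lemma additive_functor_nat_comp:
  assumes F: "additive_functor R F" and "t \<in> nat_trans R F G" "u \<in> nat_trans R G H"
  shows "nat_comp R F u t \<in> nat_trans R F H"
  using assms(2,3)
proof (rule nat_comp_nat_trans)
  show "fmap F A B f x \<in> carrier (fobj F B)"
    if "left_module R A" "left_module R B" "f \<in> lin_maps R A B" "x \<in> carrier (fobj F A)" for A B f x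
    by (rule functor_map_closed[OF F that])
  show "x \<otimes>\<^bsub>fobj F A\<^esub> y \<in> carrier (fobj F A)"
    if "left_module R A" "x \<in> carrier (fobj F A)" "y \<in> carrier (fobj F A)" for A x y
    by (rule functor_mult_closed[OF F that])
qed

lemma comm_group_surj_image:
  assumes "comm_group G" and h: "h \<in> hom G H" and surj: "h ` carrier G = carrier H"
    and one: "h \<one>\<^bsub>G\<^esub> = \<one>\<^bsub>H\<^esub>"
  shows "comm_group H"
proof -
  interpret G: comm_group G by fact
  have m: "h x \<otimes>\<^bsub>H\<^esub> h y = h (x \<otimes>\<^bsub>G\<^esub> y)" if "x \<in> carrier G" "y \<in> carrier G" for x y
    using h that by (simp add: hom_mult)
  show ?thesis
  proof (rule comm_groupI)
    fix x assume "x \<in> carrier H"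
    then obtain a where a: "a \<in> carrier G" "x = h a" using surj by blast
    then have "h (inv\<^bsub>G\<^esub> a) \<otimes>\<^bsub>H\<^esub> x = \<one>\<^bsub>H\<^esub>" by (simp add: m one)
    moreover have "h (inv\<^bsub>G\<^esub> a) \<in> carrier H" using a surj by auto
    ultimately show "\<exists>y\<in>carrier H. y \<otimes>\<^bsub>H\<^esub> x = \<one>\<^bsub>H\<^esub>" by blast
  qed (auto simp: m G.m_ac simp flip: surj one)
qed

text \<open>
  All laws of an additive functor are identities between elements, so they pass to quotients.
  The lemma is used for the cokernel of a natural transformation, and, with bijective maps, for
  carrying the laws from \<open>Hom\<^sub>R(N, -)\<close> over to the module scheme.
\<close>

lemma additive_functor_surj_image:
  fixes F :: "('u, 'v) mod_functor"
  assumes F: "additive_functor R F"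
    and hom: "\<And>A. left_module R A \<Longrightarrow> \<phi> A \<in> hom (fobj F A) (fobj G A)"
    and surj: "\<And>A. left_module R A \<Longrightarrow> \<phi> A ` carrier (fobj F A) = carrier (fobj G A)"
    and one: "\<And>A. left_module R A \<Longrightarrow> \<phi> A \<one>\<^bsub>fobj F A\<^esub> = \<one>\<^bsub>fobj G A\<^esub>"
    and ext: "\<And>A B f. \<lbrakk>left_module R A; left_module R B; f \<in> lin_maps R A B\<rbrakk> \<Longrightarrow>
      fmap G A B f \<in> extensional (carrier (fobj G A))"
    and nat: "\<And>A B f x. \<lbrakk>left_module R A; left_module R B; f \<in> lin_maps R A B;
      x \<in> carrier (fobj F A)\<rbrakk> \<Longrightarrow> fmap G A B f (\<phi> A x) = \<phi> B (fmap F A B f x)"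
  shows "additive_functor R G"
proof -
  have mem: "fmap F A B f x \<in> carrier (fobj F B)"
    if "left_module R A" "left_module R B" "f \<in> lin_maps R A B" "x \<in> carrier (fobj F A)" for A B f x
    by (rule functor_map_closed[OF F that])
  have mult: "\<phi> A x \<otimes>\<^bsub>fobj G A\<^esub> \<phi> A y = \<phi> A (x \<otimes>\<^bsub>fobj F A\<^esub> y)"
    if "left_module R A" "x \<in> carrier (fobj F A)" "y \<in> carrier (fobj F A)" for A x y
    using that hom_mult[OF hom] by simp
  have clos: "x \<otimes>\<^bsub>fobj F A\<^esub> y \<in> carrier (fobj F A)"
    if "left_module R A" "x \<in> carrier (fobj F A)" "y \<in> carrier (fobj F A)" for A x y
    by (rule functor_mult_closed[OF F that])
  show ?thesis
  proof (rule additive_functorI)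
    show "comm_group (fobj G A)" if A: "left_module R A" for A
      by (rule comm_group_surj_image[OF functor_comm_group[OF F A] hom[OF A] surj[OF A] one[OF A]])
  next
    fix A B :: "('u, 'u) module" and f assume AB: "left_module R A" "left_module R B" "f \<in> lin_maps R A B"
    show "fmap G A B f \<in> ab_homs (fobj G A) (fobj G B)"
    proof (rule ab_homsI[OF _ _ ext[OF AB]]; clarsimp simp: surj[OF AB(1), symmetric])
      fix x assume "x \<in> carrier (fobj F A)"
      then show "fmap G A B f (\<phi> A x) \<in> carrier (fobj G B)"
        using AB by (simp add: nat mem surj[symmetric])
    next
      fix x y assume "x \<in> carrier (fobj F A)" "y \<in> carrier (fobj F A)"
      then show "fmap G A B f (\<phi> A x \<otimes>\<^bsub>fobj G A\<^esub> \<phi> A y) =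
          fmap G A B f (\<phi> A x) \<otimes>\<^bsub>fobj G B\<^esub> fmap G A B f (\<phi> A y)"
        using AB by (simp add: mult nat mem clos ab_homs_mult[OF functor_map[OF F AB]])
    qed
  next
    fix A :: "('u, 'u) module" and x assume "left_module R A" "x \<in> carrier (fobj G A)"
    then show "fmap G A A (\<lambda>x\<in>carrier A. x) x = x"
      by (auto simp: surj[symmetric] nat id_lin_map functor_id[OF F])
  next
    fix A B C :: "('u, 'u) module" and f g x
    assume "left_module R A" "left_module R B" "left_module R C"
      "f \<in> lin_maps R A B" "g \<in> lin_maps R B C" "x \<in> carrier (fobj G A)"
    then show "fmap G A C (compose (carrier A) g f) x = fmap G B C g (fmap G A B f x)"
      by (auto simp: surj[symmetric] nat mem compose_lin_maps functor_comp[OF F])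
  next
    fix A B :: "('u, 'u) module" and f g x
    assume "left_module R A" "left_module R B"
      "f \<in> lin_maps R A B" "g \<in> lin_maps R A B" "x \<in> carrier (fobj G A)"
    then show "fmap G A B (\<lambda>x\<in>carrier A. f x \<oplus>\<^bsub>B\<^esub> g x) x =
        fmap G A B f x \<otimes>\<^bsub>fobj G B\<^esub> fmap G A B g x"
      by (auto simp: surj[symmetric] nat mem add_lin_maps functor_add[OF F] mult)
  qed
qed

lemma nat_trans_inverse:
  fixes F :: "('u, 'v) mod_functor" and G :: "('u, 'w) mod_functor"
  assumes F: "additive_functor R F" and G: "additive_functor R G" and \<phi>: "\<phi> \<in> nat_trans R F G"
    and bij: "\<And>A. left_module R A \<Longrightarrow> bij_betw (\<phi> A) (carrier (fobj F A)) (carrier (fobj G A))"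
  obtains \<psi> where "\<psi> \<in> nat_trans R G F"
    and "\<And>A x. \<lbrakk>left_module R A; x \<in> carrier (fobj F A)\<rbrakk> \<Longrightarrow> \<psi> A (\<phi> A x) = x"
    and "\<And>A y. \<lbrakk>left_module R A; y \<in> carrier (fobj G A)\<rbrakk> \<Longrightarrow> \<phi> A (\<psi> A y) = y"
proof -
  define \<psi> where "\<psi> = (\<lambda>A\<in>{A. left_module R A}. \<lambda>y\<in>carrier (fobj G A).
    the_inv_into (carrier (fobj F A)) (\<phi> A) y)"
  note \<phi>A = nat_trans_ab_homs[OF \<phi>]
  have closed: "\<psi> A y \<in> carrier (fobj F A)" and right: "\<phi> A (\<psi> A y) = y"
    if A: "left_module R A" and y: "y \<in> carrier (fobj G A)" for A y
    using A y bij_betwE[OF bij_betw_the_inv_into[OF bij[OF A]]]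
      f_the_inv_into_f_bij_betw[OF bij[OF A]] by (simp_all add: \<psi>_def)
  have left: "\<psi> A (\<phi> A x) = x" if A: "left_module R A" and x: "x \<in> carrier (fobj F A)" for A x
    using A x the_inv_into_f_f[OF bij_betw_imp_inj_on[OF bij[OF A]] x] ab_homs_closed[OF \<phi>A[OF A] x]
    by (simp add: \<psi>_def)
  have "\<psi> \<in> nat_trans R G F"
  proof (rule nat_transI)
    fix A :: "('u, 'u) module" assume A: "left_module R A"
    show "\<psi> A \<in> ab_homs (fobj G A) (fobj F A)"
    proof (rule ab_homsI)
      fix x y assume xy: "x \<in> carrier (fobj G A)" "y \<in> carrier (fobj G A)"
      have "x \<otimes>\<^bsub>fobj G A\<^esub> y = \<phi> A (\<psi> A x \<otimes>\<^bsub>fobj F A\<^esub> \<psi> A y)"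
        using ab_homs_mult[OF \<phi>A[OF A]] closed[OF A] right[OF A] xy by simp
      then show "\<psi> A (x \<otimes>\<^bsub>fobj G A\<^esub> y) = \<psi> A x \<otimes>\<^bsub>fobj F A\<^esub> \<psi> A y"
        using left[OF A] functor_mult_closed[OF F A] closed[OF A] xy by simp
    qed (use closed[OF A] A in \<open>auto simp: \<psi>_def\<close>)
  next
    fix A B :: "('u, 'u) module" and f y
    assume A: "left_module R A" and B: "left_module R B" and f: "f \<in> lin_maps R A B"
      and y: "y \<in> carrier (fobj G A)"
    have "\<psi> B (fmap G A B f (\<phi> A (\<psi> A y))) = \<psi> B (\<phi> B (fmap F A B f (\<psi> A y)))"
      using nat_trans_natural[OF \<phi> A B f closed[OF A y]] by simp
    then show "fmap F A B f (\<psi> A y) = \<psi> B (fmap G A B f y)"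
      using right[OF A y] left[OF B functor_map_closed[OF F A B f closed[OF A y]]] by simp
  qed (simp add: \<psi>_def)
  then show thesis using left right by (rule that)
qed

text \<open>
  Extend \<open>q\<close> from \<open>Q\<close> to \<open>P\<close> along the retraction \<open>r\<close>, lift the extension, and restrict the lift
  along \<open>i\<close>.
\<close>

lemma projective_functor_retract:
  fixes P :: "('u, 'p) mod_functor" and Q :: "('u, 'q) mod_functor"
  assumes proj: "projective_functor TYPE('v) TYPE('w) R P" and Q: "additive_functor R Q"
    and i: "i \<in> nat_trans R Q P" and r: "r \<in> nat_trans R P Q"
    and ri: "\<And>A x. \<lbrakk>left_module R A; x \<in> carrier (fobj Q A)\<rbrakk> \<Longrightarrow> r A (i A x) = x"
  shows "projective_functor TYPE('v) TYPE('w) R Q"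
  unfolding projective_functor_def
proof (intro conjI allI impI Q)
  have P: "additive_functor R P" using proj by (simp add: projective_functor_def)
  fix F :: "('u, 'v) mod_functor" and G :: "('u, 'w) mod_functor" and p q
  assume F: "additive_functor R F" and G: "additive_functor R G"
    and epi: "epi_trans R F G p" and q: "q \<in> nat_trans R Q G"
  have p: "p \<in> nat_trans R F G" using epi by (simp add: epi_trans_def)
  obtain l where l: "l \<in> nat_trans R P F" and pl: "nat_comp R P p l = nat_comp R P q r"
    using proj F G epi additive_functor_nat_comp[OF P r q] unfolding projective_functor_def by blast
  have li: "nat_comp R Q l i \<in> nat_trans R Q F"
    by (rule additive_functor_nat_comp[OF Q i l])
  have "nat_comp R Q p (nat_comp R Q l i) = q"
  proof (rule nat_trans_eqI[OF additive_functor_nat_comp[OF Q li p] q])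
    fix A :: "('u, 'u) module" and x assume A: "left_module R A" and x: "x \<in> carrier (fobj Q A)"
    have ix: "i A x \<in> carrier (fobj P A)"
      by (rule ab_homs_closed[OF nat_trans_ab_homs[OF i A] x])
    have "nat_comp R Q p (nat_comp R Q l i) A x = nat_comp R P p l A (i A x)"
      using A x ix by (simp add: nat_comp_apply)
    also have "\<dots> = q A x"
      using A x ix ri by (simp add: pl nat_comp_apply)
    finally show "nat_comp R Q p (nat_comp R Q l i) A x = q A x" .
  qed
  with li show "\<exists>l\<in>nat_trans R Q F. nat_comp R Q p l = q" by blast
qed

text \<open>
  Kernels and images of the maps of \<open>G\<close> correspond under \<open>\<phi>\<close> and its inverse to those of the maps
  of \<open>F\<close>.
\<close>

lemma left_exact_functor_natural_iso:
  fixes F :: "('u, 'v) mod_functor" and G :: "('u, 'w) mod_functor"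
  assumes lex: "left_exact_functor R F" and G: "additive_functor R G" and \<phi>: "\<phi> \<in> nat_trans R F G"
    and bij: "\<And>A. left_module R A \<Longrightarrow> bij_betw (\<phi> A) (carrier (fobj F A)) (carrier (fobj G A))"
  shows "left_exact_functor R G"
  unfolding left_exact_functor_def
proof (intro conjI allI impI G)
  have F: "additive_functor R F" using lex by (simp add: left_exact_functor_def)
  obtain \<psi> where \<psi>: "\<psi> \<in> nat_trans R G F"
    and left: "\<And>A x. \<lbrakk>left_module R A; x \<in> carrier (fobj F A)\<rbrakk> \<Longrightarrow> \<psi> A (\<phi> A x) = x"
    and right: "\<And>A y. \<lbrakk>left_module R A; y \<in> carrier (fobj G A)\<rbrakk> \<Longrightarrow> \<phi> A (\<psi> A y) = y"
    using nat_trans_inverse[OF F G \<phi> bij] by metis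
  fix A B C :: "('u, 'u) module" and f g
  assume A: "left_module R A" and B: "left_module R B" and C: "left_module R C"
    and f: "f \<in> lin_maps R A B" and g: "g \<in> lin_maps R B C" and inj: "inj_on f (carrier A)"
    and ex: "exact_seq ([add_group C, add_group B, add_group A], [g, f])"
  have injF: "inj_on (fmap F A B f) (carrier (fobj F A))"
    and exF: "exact_seq ([fobj F C, fobj F B, fobj F A], [fmap F B C g, fmap F A B f])"
    using lex A B C f g inj ex unfolding left_exact_functor_def by blast+
  have kerF: "kernel (fobj F B) (fobj F C) (fmap F B C g) = fmap F A B f ` carrier (fobj F A)"
    using exF by simp
  have \<phi>_closed: "\<phi> A x \<in> carrier (fobj G A)" if "left_module R A" "x \<in> carrier (fobj F A)" for A x
    by (rule ab_homs_closed[OF nat_trans_ab_homs[OF \<phi> that(1)] that(2)])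
  have \<psi>_closed: "\<psi> A y \<in> carrier (fobj F A)" if "left_module R A" "y \<in> carrier (fobj G A)" for A y
    by (rule ab_homs_closed[OF nat_trans_ab_homs[OF \<psi> that(1)] that(2)])
  show "inj_on (fmap G A B f) (carrier (fobj G A))"
  proof (rule inj_onI)
    fix x y assume x: "x \<in> carrier (fobj G A)" and y: "y \<in> carrier (fobj G A)"
      and eq: "fmap G A B f x = fmap G A B f y"
    have "fmap F A B f (\<psi> A x) = fmap F A B f (\<psi> A y)"
      using nat_trans_natural[OF \<psi> A B f] x y eq by simp
    then have "\<psi> A x = \<psi> A y" using inj_onD[OF injF] \<psi>_closed[OF A] x y by blast
    then have "\<phi> A (\<psi> A x) = \<phi> A (\<psi> A y)" by (rule arg_cong)
    then show "x = y" by (simp only: right[OF A x] right[OF A y])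
  qed
  have oneF: "\<psi> C \<one>\<^bsub>fobj G C\<^esub> = \<one>\<^bsub>fobj F C\<^esub>"
    by (rule hom_one[OF ab_homs_hom[OF nat_trans_ab_homs[OF \<psi> C]] functor_group[OF G C] functor_group[OF F C]])
  have oneG: "\<phi> C \<one>\<^bsub>fobj F C\<^esub> = \<one>\<^bsub>fobj G C\<^esub>"
    by (rule hom_one[OF ab_homs_hom[OF nat_trans_ab_homs[OF \<phi> C]] functor_group[OF F C] functor_group[OF G C]])
  have "kernel (fobj G B) (fobj G C) (fmap G B C g) = fmap G A B f ` carrier (fobj G A)"
  proof (intro equalityI subsetI)
    fix y assume "y \<in> kernel (fobj G B) (fobj G C) (fmap G B C g)"
    then have y: "y \<in> carrier (fobj G B)" and gy: "fmap G B C g y = \<one>\<^bsub>fobj G C\<^esub>"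
      by (auto simp: kernel_def)
    have "\<psi> B y \<in> kernel (fobj F B) (fobj F C) (fmap F B C g)"
      using nat_trans_natural[OF \<psi> B C g y] \<psi>_closed[OF B y] gy oneF by (simp add: kernel_def)
    then obtain x where x: "x \<in> carrier (fobj F A)" "\<psi> B y = fmap F A B f x"
      unfolding kerF by blast
    then have "y = fmap G A B f (\<phi> A x)"
      using right[OF B y] nat_trans_natural[OF \<phi> A B f x(1)] by simp
    then show "y \<in> fmap G A B f ` carrier (fobj G A)" using \<phi>_closed[OF A x(1)] by blast
  next
    fix y assume "y \<in> fmap G A B f ` carrier (fobj G A)"
    then obtain x where x: "x \<in> carrier (fobj G A)" and y: "y = fmap G A B f x" by blast
    have yG: "y \<in> carrier (fobj G B)" unfolding y by (rule functor_map_closed[OF G A B f x])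
    have "\<psi> B y \<in> kernel (fobj F B) (fobj F C) (fmap F B C g)"
      unfolding kerF y using nat_trans_natural[OF \<psi> A B f x] \<psi>_closed[OF A x] by (metis imageI)
    then have "fmap F B C g (\<psi> B y) = \<one>\<^bsub>fobj F C\<^esub>" by (simp add: kernel_def)
    then have "fmap G B C g y = \<one>\<^bsub>fobj G C\<^esub>"
      using nat_trans_natural[OF \<phi> B C g \<psi>_closed[OF B yG]] right[OF B yG] oneG by simp
    then show "y \<in> kernel (fobj G B) (fobj G C) (fmap G B C g)" using yG by (simp add: kernel_def)
  qed
  then show "exact_seq ([fobj G C, fobj G B, fobj G A], [fmap G B C g, fmap G A B f])"
    using functor_group[OF G A] functor_group[OF G B] functor_group[OF G C]
      ab_homs_hom[OF functor_map[OF G A B f]] ab_homs_hom[OF functor_map[OF G B C g]]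
    by (simp add: group_hom_def group_hom_axioms_def)
qed

section \<open>Epimorphisms\<close>

text \<open>
  A test functor in \<^const>\<open>epi_trans\<close> has its values on the same type as the target \<open>G\<close>, whereas
  the quotient of a group consists of sets of elements. The cokernel is therefore realised on
  chosen representatives of the cosets.
\<close>

definition coset_rep :: "'v monoid \<Rightarrow> 'v set \<Rightarrow> 'v \<Rightarrow> 'v" where
  "coset_rep G I x = (SOME y. y \<in> I #>\<^bsub>G\<^esub> x)"

definition coset_rep_group :: "'v monoid \<Rightarrow> 'v set \<Rightarrow> 'v monoid" where
  "coset_rep_group G I =
     \<lparr>carrier = coset_rep G I ` carrier G,
      monoid.mult = (\<lambda>x y. coset_rep G I (x \<otimes>\<^bsub>G\<^esub> y)),
      one = coset_rep G I \<one>\<^bsub>G\<^esub>\<rparr>"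

context
  fixes G :: "'v monoid" and I :: "'v set"
  assumes G: "comm_group G" and I: "subgroup I G"
begin

interpretation G: comm_group G by (rule G)

lemma coset_rep_mem: "x \<in> carrier G \<Longrightarrow> coset_rep G I x \<in> I #>\<^bsub>G\<^esub> x"
  unfolding coset_rep_def by (rule someI) (rule G.rcos_self[OF _ I])

lemma coset_rep_closed: "x \<in> carrier G \<Longrightarrow> coset_rep G I x \<in> carrier G"
  using coset_rep_mem G.r_coset_subset_G[OF subgroup.subset[OF I]] by blast

lemma coset_rep_coset: "x \<in> carrier G \<Longrightarrow> I #>\<^bsub>G\<^esub> coset_rep G I x = I #>\<^bsub>G\<^esub> x"
  using G.repr_independence[OF coset_rep_mem _ I] by simp

lemma coset_rep_eq_iff:
  "\<lbrakk>x \<in> carrier G; y \<in> carrier G\<rbrakk> \<Longrightarrow>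
    coset_rep G I x = coset_rep G I y \<longleftrightarrow> I #>\<^bsub>G\<^esub> x = I #>\<^bsub>G\<^esub> y"
  by (metis coset_rep_coset coset_rep_def)

lemma coset_rep_eq_one_iff: "x \<in> carrier G \<Longrightarrow> coset_rep G I x = coset_rep G I \<one>\<^bsub>G\<^esub> \<longleftrightarrow> x \<in> I"
  by (metis G.coset_join1 G.coset_join2 G.one_closed I coset_rep_eq_iff subgroup.one_closed subgroup.subset)

lemma coset_rep_mult:
  assumes "x \<in> carrier G" "y \<in> carrier G"
  shows "coset_rep G I (coset_rep G I x \<otimes>\<^bsub>G\<^esub> coset_rep G I y) = coset_rep G I (x \<otimes>\<^bsub>G\<^esub> y)"
proof -
  interpret N: normal I G
    by (rule G.subgroup_imp_normal[OF I])
  show ?thesis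
    using assms by (simp add: coset_rep_eq_iff coset_rep_closed coset_rep_coset flip: N.rcos_sum)
qed

lemma coset_rep_hom: "coset_rep G I \<in> hom G (coset_rep_group G I)"
  by (auto simp: hom_def coset_rep_group_def coset_rep_mult)

end

text \<open>
  The induced map between quotients, computed on representatives: it does not depend on whether a
  representative is chosen before \<open>h\<close> is applied.
\<close>

lemma hom_cong_coset_rep:
  assumes "comm_group G" "subgroup I G" "comm_group G'" "subgroup I' G'"
    and h: "h \<in> hom G G'" and sub: "h ` I \<subseteq> I'" and x: "x \<in> carrier G"
  shows "coset_rep G' I' (h (coset_rep G I x)) = coset_rep G' I' (h x)"
proof -
  interpret G: comm_group G by fact
  interpret G': comm_group G' by fact
  obtain i where i: "i \<in> I" "coset_rep G I x = i \<otimes>\<^bsub>G\<^esub> x"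
    using coset_rep_mem[OF assms(1,2) x] by (auto simp: r_coset_def)
  have iG: "i \<in> carrier G" using i subgroup.subset[OF assms(2)] by blast
  have "h (coset_rep G I x) \<in> I' #>\<^bsub>G'\<^esub> h x"
    using i iG sub x hom_mult[OF h] by (auto simp: r_coset_def)
  then have "I' #>\<^bsub>G'\<^esub> h x = I' #>\<^bsub>G'\<^esub> h (coset_rep G I x)"
    using G'.repr_independence[OF _ _ assms(4)] hom_in_carrier[OF h x] by blast
  then show ?thesis by (simp add: coset_rep_def)
qed

text \<open>
  The projection to the cokernel of \<open>p\<close> and the zero morphism agree after composition with \<open>p\<close>.
  If \<open>p\<close> is epi they are equal, so the cokernel vanishes at every module.
\<close>

lemma epi_trans_surj:
  fixes F :: "('u, 'v) mod_functor" and G :: "('u, 'w) mod_functor"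
  assumes F: "additive_functor R F" and G: "additive_functor R G"
    and epi: "epi_trans R F G p" and A: "left_module R A"
  shows "p A ` carrier (fobj F A) = carrier (fobj G A)"
proof -
  have p: "p \<in> nat_trans R F G" using epi by (simp add: epi_trans_def)
  define I where "I A = p A ` carrier (fobj F A)" for A
  note pA = nat_trans_ab_homs[OF p]
  have sub: "subgroup (I A) (fobj G A)" if "left_module R A" for A
  proof -
    interpret group_hom "fobj F A" "fobj G A" "p A"
      using that functor_group[OF F] functor_group[OF G] ab_homs_hom[OF pA]
      by (simp add: group_hom_def group_hom_axioms_def)
    show ?thesis unfolding I_def by (rule img_is_subgroup)
  qed
  note rep = coset_rep_closed[OF functor_comm_group[OF G] sub]
    coset_rep_eq_one_iff[OF functor_comm_group[OF G] sub]
  \<comment> \<open>the cokernel of \<open>p\<close>\<close>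
  define H :: "('u, 'w) mod_functor" where
    "H = \<lparr>fobj = (\<lambda>A. coset_rep_group (fobj G A) (I A)),
          fmap = (\<lambda>A B f. \<lambda>y \<in> carrier (coset_rep_group (fobj G A) (I A)).
            coset_rep (fobj G B) (I B) (fmap G A B f y))\<rparr>"
  have nat: "fmap H A B f (coset_rep (fobj G A) (I A) x) =
      coset_rep (fobj G B) (I B) (fmap G A B f x)"
    if AB: "left_module R A" "left_module R B" "f \<in> lin_maps R A B" "x \<in> carrier (fobj G A)" for A B f x
  proof -
    have "fmap G A B f ` I A \<subseteq> I B"
      using AB nat_trans_natural[OF p] ab_homs_closed[OF functor_map[OF F]] by (auto simp: I_def)
    then show ?thesis
      using AB hom_cong_coset_rep[OF functor_comm_group[OF G] sub functor_comm_group[OF G] sub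
          ab_homs_hom[OF functor_map[OF G]]]
      by (simp add: H_def coset_rep_group_def)
  qed
  have H: "additive_functor R H"
  proof (rule additive_functor_surj_image[OF G, where \<phi> = "\<lambda>A. coset_rep (fobj G A) (I A)"])
    show "coset_rep (fobj G A) (I A) \<in> hom (fobj G A) (fobj H A)" if "left_module R A" for A
      using coset_rep_hom[OF functor_comm_group[OF G that] sub[OF that]] by (simp add: H_def)
    show "fmap H A B f (coset_rep (fobj G A) (I A) x) =
      coset_rep (fobj G B) (I B) (fmap G A B f x)"
      if "left_module R A" "left_module R B" "f \<in> lin_maps R A B" "x \<in> carrier (fobj G A)" for A B f x
      by (rule nat[OF that])
  qed (auto simp: H_def coset_rep_group_def)
  \<comment> \<open>the projection \<open>u\<close> to the cokernel and the zero morphism \<open>v\<close>\<close>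
  define u where "u = (\<lambda>A\<in>{A. left_module R A}. \<lambda>x\<in>carrier (fobj G A). coset_rep (fobj G A) (I A) x)"
  define v where "v = (\<lambda>A\<in>{A. left_module R A}. \<lambda>x\<in>carrier (fobj G A). \<one>\<^bsub>fobj H A\<^esub>)"
  have one: "\<one>\<^bsub>fobj H A\<^esub> = coset_rep (fobj G A) (I A) \<one>\<^bsub>fobj G A\<^esub>" for A
    by (simp add: H_def coset_rep_group_def)
  have clos: "fmap G A B f x \<in> carrier (fobj G B)"
    if "left_module R A" "left_module R B" "f \<in> lin_maps R A B" "x \<in> carrier (fobj G A)" for A B f x
    by (rule functor_map_closed[OF G that])
  have m_clos: "x \<otimes>\<^bsub>fobj G A\<^esub> y \<in> carrier (fobj G A)"
    if "left_module R A" "x \<in> carrier (fobj G A)" "y \<in> carrier (fobj G A)" for A x y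
    by (rule functor_mult_closed[OF G that])
  have "u \<in> nat_trans R G H"
  proof (rule nat_transI)
    fix A :: "('u, 'u) module" assume A: "left_module R A"
    show "u A \<in> ab_homs (fobj G A) (fobj H A)"
      using A coset_rep_hom[OF functor_comm_group[OF G A] sub[OF A]] m_clos[OF A]
      by (intro ab_homsI) (auto simp: u_def H_def hom_def)
  qed (auto simp: u_def nat clos)
  moreover have "v \<in> nat_trans R G H"
  proof (rule nat_transI)
    fix A :: "('u, 'u) module" assume A: "left_module R A"
    interpret HA: comm_group "fobj H A" by (rule functor_comm_group[OF H A])
    show "v A \<in> ab_homs (fobj G A) (fobj H A)"
      using A m_clos[OF A] by (intro ab_homsI) (auto simp: v_def)
  next
    fix A B :: "('u, 'u) module" and f x
    assume AB: "left_module R A" "left_module R B" "f \<in> lin_maps R A B" "x \<in> carrier (fobj G A)"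
    have "fmap H A B f \<one>\<^bsub>fobj H A\<^esub> = \<one>\<^bsub>fobj H B\<^esub>"
      using AB hom_one[OF ab_homs_hom[OF functor_map[OF H]]] functor_group[OF H] by blast
    then show "fmap H A B f (v A x) = v B (fmap G A B f x)"
      using AB by (simp add: v_def clos)
  qed (auto simp: v_def)
  moreover have "nat_comp R F u p = nat_comp R F v p"
    unfolding nat_comp_def
  proof (intro restrict_ext)
    fix A :: "('u, 'u) module" assume "A \<in> {A. left_module R A}"
    then have A: "left_module R A" by simp
    have "u A (p A x) = v A (p A x)" if x: "x \<in> carrier (fobj F A)" for x
      using A x rep(2)[OF A] ab_homs_closed[OF pA[OF A] x] by (simp add: u_def v_def one I_def)
    then show "compose (carrier (fobj F A)) (u A) (p A) = compose (carrier (fobj F A)) (v A) (p A)"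
      by (auto simp: compose_def intro!: restrict_ext)
  qed
  ultimately have "u = v"
    using epi H unfolding epi_trans_def by blast
  have "x \<in> I A" if x: "x \<in> carrier (fobj G A)" for x
  proof -
    have "u A x = v A x" using \<open>u = v\<close> by simp
    then show ?thesis using A x by (simp add: u_def v_def one rep)
  qed
  then show ?thesis
    using subgroup.subset[OF sub[OF A]] by (auto simp: I_def)
qed

section \<open>The functor \<open>Hom\<^sub>R(N, -)\<close>\<close>

definition hom_functor :: "'u ring \<Rightarrow> ('u, 'u) module \<Rightarrow> ('u, 'u \<Rightarrow> 'u) mod_functor" where
  "hom_functor R N =
     \<lparr>fobj = (\<lambda>A. \<lparr>carrier = lin_maps R N A,
        monoid.mult = (\<lambda>f g. \<lambda>n\<in>carrier N. f n \<oplus>\<^bsub>A\<^esub> g n),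
        one = (\<lambda>n\<in>carrier N. \<zero>\<^bsub>A\<^esub>)\<rparr>),
      fmap = (\<lambda>A B h. \<lambda>f\<in>lin_maps R N A. compose (carrier N) h f)\<rparr>"

lemma hom_functor_simps [simp]:
  "carrier (fobj (hom_functor R N) A) = lin_maps R N A"
  "\<one>\<^bsub>fobj (hom_functor R N) A\<^esub> = (\<lambda>n\<in>carrier N. \<zero>\<^bsub>A\<^esub>)"
  "f \<otimes>\<^bsub>fobj (hom_functor R N) A\<^esub> g = (\<lambda>n\<in>carrier N. f n \<oplus>\<^bsub>A\<^esub> g n)"
  "fmap (hom_functor R N) A B h = (\<lambda>f\<in>lin_maps R N A. compose (carrier N) h f)"
  by (simp_all add: hom_functor_def)

lemma lin_maps_eqI:
  assumes "f \<in> lin_maps R A B" "g \<in> lin_maps R A C" "\<And>x. x \<in> carrier A \<Longrightarrow> f x = g x"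
  shows "f = g"
  using assms by (intro extensionalityI[OF lin_maps_extensional lin_maps_extensional])

lemma comm_group_hom_functor:
  assumes N: "left_module R N" and A: "left_module R A"
  shows "comm_group (fobj (hom_functor R N) A)"
proof (rule comm_groupI)
  interpret A: left_module R A by fact
  fix f assume f: "f \<in> carrier (fobj (hom_functor R N) A)"
  then show "\<exists>g\<in>carrier (fobj (hom_functor R N) A).
      g \<otimes>\<^bsub>fobj (hom_functor R N) A\<^esub> f = \<one>\<^bsub>fobj (hom_functor R N) A\<^esub>"
    using neg_lin_map[OF N A] lin_maps_closed
    by (intro bexI[where x = "\<lambda>n\<in>carrier N. \<ominus>\<^bsub>A\<^esub> f n"])
       (fastforce simp: A.M.l_neg intro!: restrict_ext)+
  have "f \<in> lin_maps R N A" using f by simp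
  then have "(\<lambda>n\<in>carrier N. \<zero>\<^bsub>A\<^esub> \<oplus>\<^bsub>A\<^esub> f n) = f"
    by (intro extensionalityI[OF restrict_extensional lin_maps_extensional])
       (simp_all add: lin_maps_closed)
  then show "\<one>\<^bsub>fobj (hom_functor R N) A\<^esub> \<otimes>\<^bsub>fobj (hom_functor R N) A\<^esub> f = f"
    by (simp cong: restrict_cong)
next
  interpret A: left_module R A by fact
  fix f g h assume "f \<in> carrier (fobj (hom_functor R N) A)" "g \<in> carrier (fobj (hom_functor R N) A)"
  then show "f \<otimes>\<^bsub>fobj (hom_functor R N) A\<^esub> g = g \<otimes>\<^bsub>fobj (hom_functor R N) A\<^esub> f"
    by (auto simp: lin_maps_closed A.M.a_comm intro!: restrict_ext)
  assume "h \<in> carrier (fobj (hom_functor R N) A)"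
  then show "f \<otimes>\<^bsub>fobj (hom_functor R N) A\<^esub> g \<otimes>\<^bsub>fobj (hom_functor R N) A\<^esub> h =
      f \<otimes>\<^bsub>fobj (hom_functor R N) A\<^esub> (g \<otimes>\<^bsub>fobj (hom_functor R N) A\<^esub> h)"
    using \<open>f \<in> _\<close> \<open>g \<in> _\<close> by (auto simp: lin_maps_closed A.M.a_assoc intro!: restrict_ext)
qed (auto intro: add_lin_maps[OF N A] zero_lin_map[OF N A])

lemma additive_hom_functor:
  fixes N :: "('u, 'u) module"
  assumes N: "left_module R N"
  shows "additive_functor R (hom_functor R N)"
proof (rule additive_functorI)
  show "comm_group (fobj (hom_functor R N) A)" if "left_module R A" for A
    by (rule comm_group_hom_functor[OF N that])
next
  fix A B :: "('u, 'u) module" and h assume AB: "left_module R A" "left_module R B" "h \<in> lin_maps R A B"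
  show "fmap (hom_functor R N) A B h \<in> ab_homs (fobj (hom_functor R N) A) (fobj (hom_functor R N) B)"
  proof (rule ab_homsI)
    fix f assume f: "f \<in> carrier (fobj (hom_functor R N) A)"
    then show "fmap (hom_functor R N) A B h f \<in> carrier (fobj (hom_functor R N) B)"
      using compose_lin_maps[OF N _ AB(3)] by simp
    fix g assume g: "g \<in> carrier (fobj (hom_functor R N) A)"
    show "fmap (hom_functor R N) A B h (f \<otimes>\<^bsub>fobj (hom_functor R N) A\<^esub> g) =
        fmap (hom_functor R N) A B h f \<otimes>\<^bsub>fobj (hom_functor R N) B\<^esub> fmap (hom_functor R N) A B h g"
      using f g add_lin_maps[OF N AB(1)] lin_maps_add[OF AB(3)]
      by (auto simp: compose_def lin_maps_closed intro!: restrict_ext)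
  qed simp
next
  fix A :: "('u, 'u) module" and f assume "left_module R A" "f \<in> carrier (fobj (hom_functor R N) A)"
  then show "fmap (hom_functor R N) A A (\<lambda>x\<in>carrier A. x) f = f"
    using compose_lin_maps[OF N _ id_lin_map]
    by (auto intro!: lin_maps_eqI simp: compose_def lin_maps_closed)
next
  fix A B C :: "('u, 'u) module" and g h f
  assume *: "left_module R A" "left_module R B" "left_module R C"
    "g \<in> lin_maps R A B" "h \<in> lin_maps R B C" "f \<in> carrier (fobj (hom_functor R N) A)"
  then show "fmap (hom_functor R N) A C (compose (carrier A) h g) f =
      fmap (hom_functor R N) B C h (fmap (hom_functor R N) A B g f)"
    using compose_lin_maps[OF N _ *(4)]
    by (auto simp: compose_def lin_maps_closed intro!: restrict_ext)
next
  fix A B :: "('u, 'u) module" and g h f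
  assume *: "left_module R A" "left_module R B"
    "g \<in> lin_maps R A B" "h \<in> lin_maps R A B" "f \<in> carrier (fobj (hom_functor R N) A)"
  then show "fmap (hom_functor R N) A B (\<lambda>x\<in>carrier A. g x \<oplus>\<^bsub>B\<^esub> h x) f =
      fmap (hom_functor R N) A B g f \<otimes>\<^bsub>fobj (hom_functor R N) B\<^esub> fmap (hom_functor R N) A B h f"
    by (auto simp: compose_def lin_maps_closed intro!: restrict_ext)
qed

text \<open>
  The natural transformation from \<open>Hom\<^sub>R(N, -)\<close> to \<open>F\<close> that corresponds to an element of \<open>F(N)\<close>
  under the Yoneda lemma.
\<close>

definition yoneda :: "'u ring \<Rightarrow> ('u, 'u) module \<Rightarrow> ('u, 'v) mod_functor \<Rightarrow> 'v \<Rightarrow>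
    ('u, 'u) module \<Rightarrow> ('u \<Rightarrow> 'u) \<Rightarrow> 'v" where
  "yoneda R N F x = (\<lambda>A\<in>{A. left_module R A}. \<lambda>f\<in>lin_maps R N A. fmap F N A f x)"

text \<open>
  Additivity of \<open>F\<close> is what makes \<open>f \<mapsto> F(f)(x)\<close> a homomorphism of groups; naturality is
  functoriality.
\<close>

lemma yoneda_nat_trans:
  fixes F :: "('u, 'v) mod_functor"
  assumes N: "left_module R N" and F: "additive_functor R F" and x: "x \<in> carrier (fobj F N)"
  shows "yoneda R N F x \<in> nat_trans R (hom_functor R N) F"
proof (rule nat_transI)
  fix A :: "('u, 'u) module" assume A: "left_module R A"
  show "yoneda R N F x A \<in> ab_homs (fobj (hom_functor R N) A) (fobj F A)"
    using A ab_homs_closed[OF functor_map[OF F N A] x] functor_add[OF F N A _ _ x]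
    by (intro ab_homsI) (auto simp: yoneda_def add_lin_maps[OF N A])
next
  fix A B :: "('u, 'u) module" and h f
  assume "left_module R A" "left_module R B" "h \<in> lin_maps R A B"
    "f \<in> carrier (fobj (hom_functor R N) A)"
  then show "fmap F A B h (yoneda R N F x A f) =
      yoneda R N F x B (fmap (hom_functor R N) A B h f)"
    using functor_comp[OF F N _ _ _ _ x] compose_lin_maps[OF N, of f A h B]
    by (simp add: yoneda_def)
qed (simp add: yoneda_def)

text \<open>
  By the Yoneda lemma a morphism \<open>q\<close> to \<open>G\<close> is determined by its value at the identity of \<open>N\<close>,
  an element of \<open>G(N)\<close>. An epimorphism \<open>p\<close> from \<open>F\<close> is surjective at \<open>N\<close>, and a preimage of this element
  in \<open>F(N)\<close> gives a lift of \<open>q\<close>.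
\<close>

lemma projective_hom_functor:
  fixes N :: "('u, 'u) module"
  assumes N: "left_module R N"
  shows "projective_functor TYPE('v) TYPE('w) R (hom_functor R N)"
  unfolding projective_functor_def
proof (intro conjI allI impI additive_hom_functor[OF N])
  fix F :: "('u, 'v) mod_functor" and G :: "('u, 'w) mod_functor" and p q
  assume F: "additive_functor R F" and G: "additive_functor R G"
    and epi: "epi_trans R F G p" and q: "q \<in> nat_trans R (hom_functor R N) G"
  have p: "p \<in> nat_trans R F G" using epi by (simp add: epi_trans_def)
  let ?i = "\<lambda>n\<in>carrier N. n"
  have i: "?i \<in> lin_maps R N N" by (rule id_lin_map[OF N])
  have "q N ?i \<in> p N ` carrier (fobj F N)"
    unfolding epi_trans_surj[OF F G epi N]
    using ab_homs_closed[OF nat_trans_ab_homs[OF q N]] i by simp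
  then obtain x where x: "x \<in> carrier (fobj F N)" "q N ?i = p N x" by blast
  let ?l = "yoneda R N F x"
  have l: "?l \<in> nat_trans R (hom_functor R N) F" by (rule yoneda_nat_trans[OF N F x(1)])
  have "nat_comp R (hom_functor R N) p ?l = q"
  proof (rule nat_trans_eqI[OF additive_functor_nat_comp[OF additive_hom_functor[OF N] l p] q])
    fix A :: "('u, 'u) module" and f assume A: "left_module R A" and "f \<in> carrier (fobj (hom_functor R N) A)"
    then have f: "f \<in> lin_maps R N A" by simp
    have fi: "compose (carrier N) f ?i = f"
      using lin_maps_extensional[OF f] by (simp add: compose_def extensional_def fun_eq_iff)
    have "nat_comp R (hom_functor R N) p ?l A f = p A (fmap F N A f x)"
      using A f by (simp add: nat_comp_apply yoneda_def)
    also have "\<dots> = fmap G N A f (q N ?i)"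
      using nat_trans_natural[OF p N A f x(1)] x(2) by simp
    also have "\<dots> = q A f"
      using nat_trans_natural[OF q N A f] i fi by simp
    finally show "nat_comp R (hom_functor R N) p ?l A f = q A f" .
  qed
  with l show "\<exists>l\<in>nat_trans R (hom_functor R N) F. nat_comp R (hom_functor R N) p l = q" by blast
qed

text \<open>
  A map to \<open>B\<close> that is killed by \<open>g\<close> takes its values in the image of \<open>f\<close>. Since \<open>f\<close> is injective,
  its inverse on the image turns that map into a linear map to \<open>A\<close>.
\<close>

lemma left_exact_hom_functor:
  fixes N :: "('u, 'u) module"
  assumes N: "left_module R N"
  shows "left_exact_functor R (hom_functor R N)"
  unfolding left_exact_functor_def
proof (intro conjI allI impI additive_hom_functor[OF N])
  fix A B C :: "('u, 'u) module" and f g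
  assume A: "left_module R A" and B: "left_module R B" and C: "left_module R C"
    and f: "f \<in> lin_maps R A B" and g: "g \<in> lin_maps R B C" and inj: "inj_on f (carrier A)"
    and ex: "exact_seq ([add_group C, add_group B, add_group A], [g, f])"
  interpret N: left_module R N by fact
  interpret A: left_module R A by fact
  let ?F = "hom_functor R N"
  have gf: "{b \<in> carrier B. g b = \<zero>\<^bsub>C\<^esub>} = f ` carrier A"
    using ex by (simp add: kernel_def add_group_def)
  note map = functor_map[OF additive_hom_functor[OF N]]
    and grp = functor_group[OF additive_hom_functor[OF N]]
  show "inj_on (fmap ?F A B f) (carrier (fobj ?F A))"
  proof (rule inj_onI)
    fix u v assume "u \<in> carrier (fobj ?F A)" "v \<in> carrier (fobj ?F A)"
      and eq: "fmap ?F A B f u = fmap ?F A B f v"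
    then have u: "u \<in> lin_maps R N A" and v: "v \<in> lin_maps R N A" by auto
    show "u = v"
    proof (rule lin_maps_eqI[OF u v])
      fix n assume n: "n \<in> carrier N"
      have "f (u n) = f (v n)"
        using fun_cong[OF eq, of n] u v n by (simp add: compose_def)
      then show "u n = v n"
        using inj u v n by (meson inj_onD lin_maps_closed)
    qed
  qed
  have "kernel (fobj ?F B) (fobj ?F C) (fmap ?F B C g) = fmap ?F A B f ` carrier (fobj ?F A)"
  proof (intro equalityI subsetI)
    fix u assume "u \<in> kernel (fobj ?F B) (fobj ?F C) (fmap ?F B C g)"
    then have u: "u \<in> lin_maps R N B" and eq: "compose (carrier N) g u = (\<lambda>n\<in>carrier N. \<zero>\<^bsub>C\<^esub>)"
      by (auto simp: kernel_def)
    have im: "u n \<in> f ` carrier A" if n: "n \<in> carrier N" for n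
      using fun_cong[OF eq, of n] n gf lin_maps_closed[OF u n] by (auto simp: compose_def)
    define w where "w = (\<lambda>n\<in>carrier N. the_inv_into (carrier A) f (u n))"
    have wA: "w n \<in> carrier A" and fw: "f (w n) = u n" if "n \<in> carrier N" for n
      using im[OF that] that the_inv_into_into[OF inj] f_the_inv_into_f[OF inj]
      by (auto simp: w_def)
    have w: "w \<in> lin_maps R N A"
    proof (rule lin_mapsI)
      fix n m assume nm: "n \<in> carrier N" "m \<in> carrier N"
      show "w (n \<oplus>\<^bsub>N\<^esub> m) = w n \<oplus>\<^bsub>A\<^esub> w m"
        by (rule inj_onD[OF inj]) (use nm in \<open>simp_all add: wA fw lin_maps_add[OF f] lin_maps_add[OF u]\<close>)
    next
      fix r n assume rn: "r \<in> carrier R" "n \<in> carrier N"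
      show "w (r \<odot>\<^bsub>N\<^esub> n) = r \<odot>\<^bsub>A\<^esub> w n"
        by (rule inj_onD[OF inj])
           (use rn in \<open>simp_all add: wA fw N.smult_closed A.smult_closed lin_maps_smult[OF f] lin_maps_smult[OF u]\<close>)
    qed (auto simp: wA, simp add: w_def)
    have "compose (carrier N) f w = u"
      by (rule lin_maps_eqI[OF compose_lin_maps[OF N w f] u]) (simp add: compose_def fw)
    then show "u \<in> fmap ?F A B f ` carrier (fobj ?F A)"
      using w by (auto intro!: image_eqI[where x = w])
  next
    fix u assume "u \<in> fmap ?F A B f ` carrier (fobj ?F A)"
    then obtain w where w: "w \<in> lin_maps R N A" "u = compose (carrier N) f w" by auto
    have "g (f (w n)) = \<zero>\<^bsub>C\<^esub>" if "n \<in> carrier N" for n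
      using gf lin_maps_closed[OF w(1) that] by blast
    then show "u \<in> kernel (fobj ?F B) (fobj ?F C) (fmap ?F B C g)"
      using compose_lin_maps[OF N w(1) f] w(2)
      by (auto simp: kernel_def compose_def intro!: restrict_ext)
  qed
  then show "exact_seq ([fobj ?F C, fobj ?F B, fobj ?F A], [fmap ?F B C g, fmap ?F A B f])"
    using grp[OF A] grp[OF B] grp[OF C] ab_homs_hom[OF map[OF A B f]] ab_homs_hom[OF map[OF B C g]]
    by (simp add: group_hom_def group_hom_axioms_def)
qed


section \<open>Tensor products\<close>

lemma opp_ring_simps [simp]:
  "carrier (opp_ring R) = carrier R"
  "x \<otimes>\<^bsub>opp_ring R\<^esub> y = y \<otimes>\<^bsub>R\<^esub> x"
  "\<one>\<^bsub>opp_ring R\<^esub> = \<one>\<^bsub>R\<^esub>"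
  "x \<oplus>\<^bsub>opp_ring R\<^esub> y = x \<oplus>\<^bsub>R\<^esub> y"
  "\<zero>\<^bsub>opp_ring R\<^esub> = \<zero>\<^bsub>R\<^esub>"
  by (simp_all add: opp_ring_def)

abbreviation tensor_class ::
  "'a ring \<Rightarrow> ('a, 'b) module \<Rightarrow> ('a, 'c) module \<Rightarrow> ('b \<times> 'c \<Rightarrow>\<^sub>0 int) \<Rightarrow> ('b \<times> 'c \<Rightarrow>\<^sub>0 int) set" where
  "tensor_class R S N x \<equiv> tensor_rels R S N #>\<^bsub>free_Abelian_group (carrier S \<times> carrier N)\<^esub> x"

definition pure_tensor ::
  "'a ring \<Rightarrow> ('a, 'b) module \<Rightarrow> ('a, 'c) module \<Rightarrow> 'b \<Rightarrow> 'c \<Rightarrow> ('b \<times> 'c \<Rightarrow>\<^sub>0 int) set" where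
  "pure_tensor R S N s n = tensor_class R S N (frag_of (s, n))"

lemma free_Abelian_group_diff_closed:
  "\<lbrakk>x \<in> carrier (free_Abelian_group U); y \<in> carrier (free_Abelian_group U)\<rbrakk> \<Longrightarrow>
    x - y \<in> carrier (free_Abelian_group U)"
  using keys_diff[of x y] by auto

context
  fixes R :: "'a ring" and S :: "('a, 'b) module" and N :: "('a, 'c) module"
  assumes S: "right_module R S" and N: "left_module R N"
begin

interpretation S: left_module "opp_ring R" S by (rule S)
interpretation N: left_module R N by (rule N)

abbreviation (input) free_pairs where "free_pairs \<equiv> free_Abelian_group (carrier S \<times> carrier N)"

interpretation free: comm_group free_pairs by (rule abelian_free_Abelian_group)

lemma subgroup_tensor_rels: "subgroup (tensor_rels R S N) free_pairs"
  unfolding tensor_rels_def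
  by (rule free.generate_is_subgroup)
     (use S.smult_closed N.smult_closed in
       \<open>auto intro!: free_Abelian_group_diff_closed simp del: carrier_free_Abelian_group_iff\<close>)

interpretation rels: normal "tensor_rels R S N" free_pairs
  by (rule free.subgroup_imp_normal[OF subgroup_tensor_rels])

lemma comm_group_tensor: "comm_group (tensor R S N)"
  unfolding tensor_def by (rule free.abelian_FactGroup[OF subgroup_tensor_rels])

lemma tensor_class_hom: "tensor_class R S N \<in> hom free_pairs (tensor R S N)"
  unfolding tensor_def by (rule rels.r_coset_hom_Mod)

lemma carrier_tensor: "carrier (tensor R S N) = tensor_class R S N ` carrier free_pairs"
  unfolding tensor_def by (rule carrier_FactGroup)

lemma tensor_class_eqI:
  assumes "x \<in> carrier free_pairs" "y \<in> carrier free_pairs" "x - y \<in> tensor_rels R S N"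
  shows "tensor_class R S N x = tensor_class R S N y"
proof -
  have "x \<in> tensor_class R S N y"
    using assms(3) by (auto simp: r_coset_def intro!: bexI[where x = "x - y"])
  then show ?thesis
    using free.repr_independence[OF _ assms(2) subgroup_tensor_rels] by simp
qed

lemma pure_tensor_closed:
  "\<lbrakk>s \<in> carrier S; n \<in> carrier N\<rbrakk> \<Longrightarrow> pure_tensor R S N s n \<in> carrier (tensor R S N)"
  unfolding pure_tensor_def carrier_tensor by (intro imageI) simp

lemma pure_tensor_add_left:
  assumes "s \<in> carrier S" "s' \<in> carrier S" "n \<in> carrier N"
  shows "pure_tensor R S N (s \<oplus>\<^bsub>S\<^esub> s') n =
    pure_tensor R S N s n \<otimes>\<^bsub>tensor R S N\<^esub> pure_tensor R S N s' n"
proof -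
  have "frag_of (s \<oplus>\<^bsub>S\<^esub> s', n) - frag_of (s, n) - frag_of (s', n) \<in> tensor_rels R S N"
    unfolding tensor_rels_def using assms by (intro generate.incl) auto
  then have "tensor_class R S N (frag_of (s \<oplus>\<^bsub>S\<^esub> s', n)) =
      tensor_class R S N (frag_of (s, n) \<otimes>\<^bsub>free_pairs\<^esub> frag_of (s', n))"
    using assms by (intro tensor_class_eqI free.m_closed) (auto simp: diff_diff_eq)
  then show ?thesis
    using assms hom_mult[OF tensor_class_hom] unfolding pure_tensor_def by simp
qed

lemma pure_tensor_add_right:
  assumes "s \<in> carrier S" "n \<in> carrier N" "n' \<in> carrier N"
  shows "pure_tensor R S N s (n \<oplus>\<^bsub>N\<^esub> n') =
    pure_tensor R S N s n \<otimes>\<^bsub>tensor R S N\<^esub> pure_tensor R S N s n'"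
proof -
  have "frag_of (s, n \<oplus>\<^bsub>N\<^esub> n') - frag_of (s, n) - frag_of (s, n') \<in> tensor_rels R S N"
    unfolding tensor_rels_def using assms by (intro generate.incl) auto
  then have "tensor_class R S N (frag_of (s, n \<oplus>\<^bsub>N\<^esub> n')) =
      tensor_class R S N (frag_of (s, n) \<otimes>\<^bsub>free_pairs\<^esub> frag_of (s, n'))"
    using assms by (intro tensor_class_eqI free.m_closed) (auto simp: diff_diff_eq)
  then show ?thesis
    using assms hom_mult[OF tensor_class_hom] unfolding pure_tensor_def by simp
qed

lemma pure_tensor_balanced:
  assumes "r \<in> carrier R" "s \<in> carrier S" "n \<in> carrier N"
  shows "pure_tensor R S N (r \<odot>\<^bsub>S\<^esub> s) n = pure_tensor R S N s (r \<odot>\<^bsub>N\<^esub> n)"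
proof -
  have "frag_of (r \<odot>\<^bsub>S\<^esub> s, n) - frag_of (s, r \<odot>\<^bsub>N\<^esub> n) \<in> tensor_rels R S N"
    unfolding tensor_rels_def using assms by (intro generate.incl) auto
  then show ?thesis
    unfolding pure_tensor_def
    using assms S.smult_closed N.smult_closed by (intro tensor_class_eqI) auto
qed

text \<open>
  The pure tensors generate the tensor product.
\<close>

lemma tensor_hom_eqI:
  assumes h: "h \<in> hom (tensor R S N) H" and k: "k \<in> hom (tensor R S N) H" and H: "group H"
    and eq: "\<And>s n. \<lbrakk>s \<in> carrier S; n \<in> carrier N\<rbrakk> \<Longrightarrow>
      h (pure_tensor R S N s n) = k (pure_tensor R S N s n)"
    and z: "z \<in> carrier (tensor R S N)"
  shows "h z = k z"
proof -
  interpret T: comm_group "tensor R S N" by (rule comm_group_tensor)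
  interpret H: group H by fact
  interpret h: group_hom "tensor R S N" H h
    by (simp add: group_hom_def group_hom_axioms_def h T.is_group H.is_group)
  interpret k: group_hom "tensor R S N" H k
    by (simp add: group_hom_def group_hom_axioms_def k T.is_group H.is_group)
  interpret q: group_hom free_pairs "tensor R S N" "tensor_class R S N"
    by (simp add: group_hom_def group_hom_axioms_def T.is_group tensor_class_hom)
  obtain x where x: "x \<in> carrier free_pairs" "z = tensor_class R S N x"
    using z by (auto simp: carrier_tensor)
  have "Poly_Mapping.keys x \<subseteq> carrier S \<times> carrier N" using x by simp
  then have "h (tensor_class R S N x) = k (tensor_class R S N x)"
  proof (rule free_Abelian_group_induct)
    show "h (tensor_class R S N 0) = k (tensor_class R S N 0)"
      using q.hom_one by simp
  next
    fix x y assume "Poly_Mapping.keys x \<subseteq> carrier S \<times> carrier N"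
      and "Poly_Mapping.keys y \<subseteq> carrier S \<times> carrier N"
      and eqs: "h (tensor_class R S N x) = k (tensor_class R S N x)"
        "h (tensor_class R S N y) = k (tensor_class R S N y)"
    then have xy: "x \<in> carrier free_pairs" "y \<in> carrier free_pairs" by simp_all
    then have "x - y = x \<otimes>\<^bsub>free_pairs\<^esub> inv\<^bsub>free_pairs\<^esub> y" by simp
    then show "h (tensor_class R S N (x - y)) = k (tensor_class R S N (x - y))"
      using xy eqs by (simp only: q.hom_mult q.hom_inv h.hom_mult h.hom_inv
        k.hom_mult k.hom_inv free.inv_closed q.hom_closed T.inv_closed)
  next
    fix a assume "a \<in> carrier S \<times> carrier N"
    then show "h (tensor_class R S N (frag_of a)) = k (tensor_class R S N (frag_of a))"
      using eq by (auto simp: pure_tensor_def)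
  qed
  then show ?thesis using x by simp
qed

lemma tensor_ab_homs_eqI:
  assumes h: "h \<in> ab_homs (tensor R S N) H" and k: "k \<in> ab_homs (tensor R S N) H" and H: "group H"
    and eq: "\<And>s n. \<lbrakk>s \<in> carrier S; n \<in> carrier N\<rbrakk> \<Longrightarrow>
      h (pure_tensor R S N s n) = k (pure_tensor R S N s n)"
  shows "h = k"
  by (rule extensionalityI[OF ab_homs_extensional[OF h] ab_homs_extensional[OF k]])
     (rule tensor_hom_eqI[OF ab_homs_hom[OF h] ab_homs_hom[OF k] H eq])

text \<open>
  The universal property in terms of homomorphisms on the free group: those that respect the three
  families of relators vanish on the subgroup generated by the relators. In this form the lemma also
  applies to the map by which \<^const>\<open>tensor_map\<close> is defined.
\<close>

lemma tensor_class_induced_hom: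
  assumes H: "comm_group H" and k: "k \<in> hom free_pairs H"
    and add_left: "\<And>s s' n. \<lbrakk>s \<in> carrier S; s' \<in> carrier S; n \<in> carrier N\<rbrakk> \<Longrightarrow>
      k (frag_of (s \<oplus>\<^bsub>S\<^esub> s', n)) = k (frag_of (s, n)) \<otimes>\<^bsub>H\<^esub> k (frag_of (s', n))"
    and add_right: "\<And>s n n'. \<lbrakk>s \<in> carrier S; n \<in> carrier N; n' \<in> carrier N\<rbrakk> \<Longrightarrow>
      k (frag_of (s, n \<oplus>\<^bsub>N\<^esub> n')) = k (frag_of (s, n)) \<otimes>\<^bsub>H\<^esub> k (frag_of (s, n'))"
    and balanced: "\<And>r s n. \<lbrakk>r \<in> carrier R; s \<in> carrier S; n \<in> carrier N\<rbrakk> \<Longrightarrow>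
      k (frag_of (r \<odot>\<^bsub>S\<^esub> s, n)) = k (frag_of (s, r \<odot>\<^bsub>N\<^esub> n))"
  obtains h where "h \<in> hom (tensor R S N) H"
    "\<And>x. x \<in> carrier free_pairs \<Longrightarrow> h (tensor_class R S N x) = k x"
proof -
  interpret H: comm_group H by fact
  interpret k: group_hom free_pairs H k
    by (simp add: group_hom_def group_hom_axioms_def k H.is_group)
  have diff: "x - y \<in> kernel free_pairs H k"
    if "x \<in> carrier free_pairs" "y \<in> carrier free_pairs" "k x = k y" for x y
  proof -
    have xy: "x - y \<in> carrier free_pairs" by (rule free_Abelian_group_diff_closed[OF that(1,2)])
    have "k x = k (x - y) \<otimes>\<^bsub>H\<^esub> k y"
      using k.hom_mult[OF xy that(2)] by simp
    then have "k (x - y) = \<one>\<^bsub>H\<^esub>"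
      using that xy k.hom_closed by (metis H.r_cancel_one')
    then show ?thesis using xy by (simp add: kernel_def)
  qed
  have fr: "frag_of (s, n) \<in> carrier free_pairs" if "s \<in> carrier S" "n \<in> carrier N" for s n
    using that by simp
  have diff3: "frag_of a - frag_of b - frag_of c \<in> kernel free_pairs H k"
    if "a \<in> carrier S \<times> carrier N" "b \<in> carrier S \<times> carrier N" "c \<in> carrier S \<times> carrier N"
      and "k (frag_of a) = k (frag_of b) \<otimes>\<^bsub>H\<^esub> k (frag_of c)" for a b c
  proof -
    have abc: "frag_of a \<in> carrier free_pairs" "frag_of b \<in> carrier free_pairs" "frag_of c \<in> carrier free_pairs"
      using that by simp_all
    have "frag_of a - (frag_of b \<otimes>\<^bsub>free_pairs\<^esub> frag_of c) \<in> kernel free_pairs H k"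
      using abc that(4) by (intro diff free.m_closed) (simp_all only: k.hom_mult)
    then show ?thesis by (simp add: diff_diff_eq)
  qed
  have ker: "tensor_rels R S N \<subseteq> kernel free_pairs H k"
    unfolding tensor_rels_def
  proof (rule free.generate_subgroup_incl[OF _ k.subgroup_kernel], intro Un_least subsetI)
    fix x assume "x \<in> {frag_of (s \<oplus>\<^bsub>S\<^esub> s', n) - frag_of (s, n) - frag_of (s', n) | s s' n.
         s \<in> carrier S \<and> s' \<in> carrier S \<and> n \<in> carrier N}"
    then show "x \<in> kernel free_pairs H k" using add_left by (auto intro!: diff3)
  next
    fix x assume "x \<in> {frag_of (s, n \<oplus>\<^bsub>N\<^esub> n') - frag_of (s, n) - frag_of (s, n') | s n n'.
         s \<in> carrier S \<and> n \<in> carrier N \<and> n' \<in> carrier N}"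
    then show "x \<in> kernel free_pairs H k" using add_right by (auto intro!: diff3)
  next
    fix x assume "x \<in> {frag_of (r \<odot>\<^bsub>S\<^esub> s, n) - frag_of (s, r \<odot>\<^bsub>N\<^esub> n) | r s n.
         r \<in> carrier R \<and> s \<in> carrier S \<and> n \<in> carrier N}"
    then show "x \<in> kernel free_pairs H k"
      using balanced S.smult_closed N.smult_closed by (auto intro!: diff)
  qed
  have "k x = k y"
    if "x \<in> carrier free_pairs" "y \<in> carrier free_pairs" "tensor_class R S N x = tensor_class R S N y" for x y
  proof -
    have "x \<in> tensor_class R S N y"
      using free.rcos_self[OF that(1) subgroup_tensor_rels] that(3) by simp
    then obtain d where d: "d \<in> tensor_rels R S N" "x = d \<otimes>\<^bsub>free_pairs\<^esub> y"
      by (auto simp: r_coset_def)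
    then have "d \<in> carrier free_pairs" "k d = \<one>\<^bsub>H\<^esub>" using ker by (auto simp: kernel_def)
    then show ?thesis using that(2) d(2) k.hom_closed[OF that(2)] by (simp only: k.hom_mult H.l_one)
  qed
  then obtain h where "h \<in> hom (free_pairs Mod tensor_rels R S N) H"
    "\<And>x. x \<in> carrier free_pairs \<Longrightarrow> h (tensor_class R S N x) = k x"
    using FactGroup_universal[OF k rels.normal_axioms] by blast
  then show thesis using that by (simp add: tensor_def)
qed

lemma tensor_universal:
  assumes H: "comm_group H"
    and closed: "\<And>s n. \<lbrakk>s \<in> carrier S; n \<in> carrier N\<rbrakk> \<Longrightarrow> b s n \<in> carrier H"
    and add_left: "\<And>s s' n. \<lbrakk>s \<in> carrier S; s' \<in> carrier S; n \<in> carrier N\<rbrakk> \<Longrightarrow>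
      b (s \<oplus>\<^bsub>S\<^esub> s') n = b s n \<otimes>\<^bsub>H\<^esub> b s' n"
    and add_right: "\<And>s n n'. \<lbrakk>s \<in> carrier S; n \<in> carrier N; n' \<in> carrier N\<rbrakk> \<Longrightarrow>
      b s (n \<oplus>\<^bsub>N\<^esub> n') = b s n \<otimes>\<^bsub>H\<^esub> b s n'"
    and balanced: "\<And>r s n. \<lbrakk>r \<in> carrier R; s \<in> carrier S; n \<in> carrier N\<rbrakk> \<Longrightarrow>
      b (r \<odot>\<^bsub>S\<^esub> s) n = b s (r \<odot>\<^bsub>N\<^esub> n)"
  obtains h where "h \<in> hom (tensor R S N) H"
    "\<And>s n. \<lbrakk>s \<in> carrier S; n \<in> carrier N\<rbrakk> \<Longrightarrow> h (pure_tensor R S N s n) = b s n"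
proof -
  have "(\<lambda>(s, n). b s n) ` (carrier S \<times> carrier N) \<subseteq> carrier H"
    using closed by auto
  then obtain k where k: "k \<in> hom free_pairs H"
    "\<And>x. x \<in> carrier S \<times> carrier N \<Longrightarrow> k (frag_of x) = (\<lambda>(s, n). b s n) x"
    using comm_group.free_Abelian_group_universal[OF H] by blast
  obtain h where "h \<in> hom (tensor R S N) H"
    "\<And>x. x \<in> carrier free_pairs \<Longrightarrow> h (tensor_class R S N x) = k x"
    by (rule tensor_class_induced_hom[OF H k(1)])
       (use k(2) add_left add_right balanced S.smult_closed N.smult_closed in auto)
  then show thesis using that k(2) by (simp add: pure_tensor_def)
qed

end

text \<open>
  \<^const>\<open>tensor_map\<close> picks the only element of an image of a coset. The induced homomorphism \<open>h\<close>
  shows that the map on the free group is constant modulo the relations on every coset, so that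
  there is exactly one such element and it is the value of \<open>h\<close>.
\<close>

lemma tensor_map:
  fixes R :: "'a ring" and S :: "('a, 'b) module" and N :: "('a, 'c) module"
    and S' :: "('a, 'd) module" and N' :: "('a, 'e) module"
  assumes S: "right_module R S" and N: "left_module R N"
    and S': "right_module R S'" and N': "left_module R N'"
    and g: "g \<in> lin_maps (opp_ring R) S S'" and f: "f \<in> lin_maps R N N'"
  shows tensor_map_ab_homs: "tensor_map R S N S' N' g f \<in> ab_homs (tensor R S N) (tensor R S' N')"
    and tensor_map_pure: "\<lbrakk>s \<in> carrier S; n \<in> carrier N\<rbrakk> \<Longrightarrow>
      tensor_map R S N S' N' g f (pure_tensor R S N s n) = pure_tensor R S' N' (g s) (f n)"
proof -
  interpret S: left_module "opp_ring R" S by fact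
  interpret N: left_module R N by fact
  interpret T: comm_group "tensor R S N" by (rule comm_group_tensor[OF S N])
  interpret T': comm_group "tensor R S' N'" by (rule comm_group_tensor[OF S' N'])
  let ?F = "free_Abelian_group (carrier S \<times> carrier N)"
  let ?F' = "free_Abelian_group (carrier S' \<times> carrier N')"
  let ?e = "frag_extend (\<lambda>(s, n). frag_of (g s, f n))"
  let ?k = "\<lambda>x. tensor_class R S' N' (?e x)"
  have e: "?e x \<in> carrier ?F'" if "x \<in> carrier ?F" for x
  proof -
    have "Poly_Mapping.keys (?e x) \<subseteq> (\<Union>y\<in>Poly_Mapping.keys x. {(g (fst y), f (snd y))})"
      using keys_frag_extend[of "\<lambda>(s, n). frag_of (g s, f n)" x] by (simp add: case_prod_unfold)
    also have "\<dots> \<subseteq> carrier S' \<times> carrier N'"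
      using that by (auto intro!: lin_maps_closed[OF g] lin_maps_closed[OF f])
    finally show ?thesis by simp
  qed
  then have ehom: "?e \<in> hom ?F ?F'"
    by (intro homI) (simp_all only: mult_free_Abelian_group frag_extend_add)
  have k: "?k \<in> hom ?F (tensor R S' N')"
    using hom_compose[OF ehom tensor_class_hom[OF S' N']] by (simp add: o_def)
  have kp: "?k (frag_of (s, n)) = pure_tensor R S' N' (g s) (f n)" for s n
    by (simp add: pure_tensor_def)
  obtain h where h: "h \<in> hom (tensor R S N) (tensor R S' N')"
    and hk: "\<And>x. x \<in> carrier ?F \<Longrightarrow> h (tensor_class R S N x) = ?k x"
    by (rule tensor_class_induced_hom[OF S N T'.comm_group_axioms k, unfolded kp])
       (use g f in \<open>auto simp: lin_mapsD lin_maps_smult[OF g, simplified] pure_tensor_add_left[OF S' N']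
         pure_tensor_add_right[OF S' N'] pure_tensor_balanced[OF S' N']\<close>)
  have eq: "tensor_map R S N S' N' g f z = h z" if z: "z \<in> carrier (tensor R S N)" for z
  proof -
    obtain x where x: "x \<in> carrier ?F" "z = tensor_class R S N x"
      using z by (auto simp: carrier_tensor[OF S N])
    interpret F: comm_group ?F by (rule abelian_free_Abelian_group)
    note sub = subgroup_tensor_rels[OF S N]
    have "?k y = h z" if "y \<in> z" for y
    proof -
      have y: "y \<in> carrier ?F"
        using that x F.r_coset_subset_G[OF subgroup.subset[OF sub]] by blast
      have "tensor_class R S N y = z"
        using F.repr_independence[OF _ x(1) sub] that x(2) by simp
      then show ?thesis using hk[OF y] by simp
    qed
    moreover have "x \<in> z" using F.rcos_self[OF x(1) sub] x(2) by simp
    ultimately have "?k ` z = {h z}" by force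
    then show ?thesis using z by (simp add: tensor_map_def)
  qed
  show "tensor_map R S N S' N' g f \<in> ab_homs (tensor R S N) (tensor R S' N')"
  proof (rule ab_homsI)
    show "tensor_map R S N S' N' g f \<in> extensional (carrier (tensor R S N))"
      by (simp add: tensor_map_def)
  qed (simp_all add: eq hom_in_carrier[OF h] hom_mult[OF h])
  assume "s \<in> carrier S" "n \<in> carrier N"
  then show "tensor_map R S N S' N' g f (pure_tensor R S N s n) = pure_tensor R S' N' (g s) (f n)"
    using eq pure_tensor_closed[OF S N] hk kp by (simp add: pure_tensor_def)
qed

section \<open>Morphisms between quasi-coherent modules\<close>

lemma quasi_coherent_simps [simp]:
  "fobj (quasi_coherent R N) S = tensor R S N"
  "fmap (quasi_coherent R N) S S' g = tensor_map R S N S' N g (\<lambda>n\<in>carrier N. n)"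
  by (simp_all add: quasi_coherent_def)

lemma module_scheme_simps [simp]:
  "carrier (fobj (module_scheme R N) A) =
    nat_trans (opp_ring R) (quasi_coherent R N) (quasi_coherent R A)"
  "t \<otimes>\<^bsub>fobj (module_scheme R N) A\<^esub> u =
    (\<lambda>S\<in>{S. right_module R S}. \<lambda>x\<in>carrier (tensor R S N). t S x \<otimes>\<^bsub>tensor R S A\<^esub> u S x)"
  "\<one>\<^bsub>fobj (module_scheme R N) A\<^esub> =
    (\<lambda>S\<in>{S. right_module R S}. \<lambda>x\<in>carrier (tensor R S N). \<one>\<^bsub>tensor R S A\<^esub>)"
  "fmap (module_scheme R N) A B f =
    (\<lambda>t\<in>nat_trans (opp_ring R) (quasi_coherent R N) (quasi_coherent R A).
      nat_comp (opp_ring R) (quasi_coherent R N) (quasi_coherent_map R A B f) t)"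
  by (simp_all add: module_scheme_def nat_trans_group_def)

lemma quasi_coherent_nat_trans_eqI:
  fixes N :: "('u, 'u) module"
  assumes N: "left_module R N" and A: "left_module R A"
    and t: "t \<in> nat_trans (opp_ring R) (quasi_coherent R N) (quasi_coherent R A)"
    and u: "u \<in> nat_trans (opp_ring R) (quasi_coherent R N) (quasi_coherent R A)"
    and eq: "\<And>S s n. \<lbrakk>right_module R S; s \<in> carrier S; n \<in> carrier N\<rbrakk> \<Longrightarrow>
      t S (pure_tensor R S N s n) = u S (pure_tensor R S N s n)"
  shows "t = u"
proof (rule nat_trans_eqI[OF t u])
  fix S :: "('u, 'u) module" and x
  assume S: "right_module R S" and x: "x \<in> carrier (fobj (quasi_coherent R N) S)"
  have "t S \<in> ab_homs (tensor R S N) (tensor R S A)" "u S \<in> ab_homs (tensor R S N) (tensor R S A)"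
    using nat_trans_ab_homs[OF t S] nat_trans_ab_homs[OF u S] by simp_all
  then have "t S = u S"
    by (rule tensor_ab_homs_eqI[OF S N])
       (use comm_group_tensor[OF S A] eq[OF S] in \<open>auto simp: comm_group_def\<close>)
  then show "t S x = u S x" by simp
qed

lemma quasi_coherent_map_pure:
  assumes N: "left_module R N" and A: "left_module R A" and f: "f \<in> lin_maps R N A"
    and S: "right_module R S" and s: "s \<in> carrier S" and n: "n \<in> carrier N"
  shows "quasi_coherent_map R N A f S (pure_tensor R S N s n) = pure_tensor R S A s (f n)"
  using S s n by (simp add: quasi_coherent_map_def tensor_map_pure[OF S N S A id_lin_map[OF S] f])

lemma quasi_coherent_map_nat_trans:
  fixes N A :: "('u, 'u) module"
  assumes N: "left_module R N" and A: "left_module R A" and f: "f \<in> lin_maps R N A"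
  shows "quasi_coherent_map R N A f \<in> nat_trans (opp_ring R) (quasi_coherent R N) (quasi_coherent R A)"
proof (rule nat_transI)
  show "quasi_coherent_map R N A f \<in> extensional {S. right_module R S}"
    by (simp add: quasi_coherent_map_def)
next
  fix S :: "('u, 'u) module" assume S: "right_module R S"
  then show "quasi_coherent_map R N A f S \<in> ab_homs (fobj (quasi_coherent R N) S) (fobj (quasi_coherent R A) S)"
    using tensor_map_ab_homs[OF S N S A id_lin_map[OF S] f] by (simp add: quasi_coherent_map_def)
next
  fix S S' :: "('u, 'u) module" and g x
  assume S: "right_module R S" and S': "right_module R S'" and g: "g \<in> lin_maps (opp_ring R) S S'"
    and x: "x \<in> carrier (fobj (quasi_coherent R N) S)"
  let ?q = "quasi_coherent_map R N A f"
  let ?N = "tensor_map R S N S' N g (\<lambda>n\<in>carrier N. n)"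
  let ?A = "tensor_map R S A S' A g (\<lambda>n\<in>carrier A. n)"
  have q: "?q T \<in> hom (tensor R T N) (tensor R T A)" if T: "right_module R T" for T
    using ab_homs_hom[OF tensor_map_ab_homs[OF T N T A id_lin_map[OF T] f]] T
    by (simp add: quasi_coherent_map_def)
  have "(?A \<circ> ?q S) x = (?q S' \<circ> ?N) x"
  proof (rule tensor_hom_eqI[OF S N, where H = "tensor R S' A" and h = "?A \<circ> ?q S" and k = "?q S' \<circ> ?N"])
    show "?A \<circ> ?q S \<in> hom (tensor R S N) (tensor R S' A)"
      using ab_homs_hom[OF tensor_map_ab_homs[OF S A S' A g id_lin_map[OF A]]] q[OF S]
      by (rule hom_compose[rotated])
    show "?q S' \<circ> ?N \<in> hom (tensor R S N) (tensor R S' A)"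
      using ab_homs_hom[OF tensor_map_ab_homs[OF S N S' N g id_lin_map[OF N]]] q[OF S']
      by (rule hom_compose)
    show "group (tensor R S' A)"
      using comm_group_tensor[OF S' A] by (simp add: comm_group_def)
    show "x \<in> carrier (tensor R S N)" using x by simp
    fix s n assume s: "s \<in> carrier S" and n: "n \<in> carrier N"
    then show "(?A \<circ> ?q S) (pure_tensor R S N s n) = (?q S' \<circ> ?N) (pure_tensor R S N s n)"
      using lin_maps_closed[OF f] lin_maps_closed[OF g]
      by (simp add: quasi_coherent_map_pure[OF N A f S] quasi_coherent_map_pure[OF N A f S']
          tensor_map_pure[OF S A S' A g id_lin_map[OF A]] tensor_map_pure[OF S N S' N g id_lin_map[OF N]])
  qed
  then show "fmap (quasi_coherent R A) S S' g (?q S x) = ?q S' (fmap (quasi_coherent R N) S S' g x)"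
    by simp
qed

lemma quasi_coherent_map_add:
  assumes N: "left_module R N" and A: "left_module R A"
    and f: "f \<in> lin_maps R N A" and g: "g \<in> lin_maps R N A"
  shows "quasi_coherent_map R N A (\<lambda>n\<in>carrier N. f n \<oplus>\<^bsub>A\<^esub> g n) =
    quasi_coherent_map R N A f \<otimes>\<^bsub>fobj (module_scheme R N) A\<^esub> quasi_coherent_map R N A g"
    (is "?fg = ?f \<otimes>\<^bsub>_\<^esub> ?g")
proof -
  note fg = add_lin_maps[OF N A f g]
  note ab = nat_trans_ab_homs[OF quasi_coherent_map_nat_trans[OF N A], simplified]
  have "?fg S = (\<lambda>x\<in>carrier (tensor R S N). ?f S x \<otimes>\<^bsub>tensor R S A\<^esub> ?g S x)"
    if S: "right_module R S" for S
  proof (rule tensor_ab_homs_eqI[OF S N ab[OF fg S]])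
    interpret T: comm_group "tensor R S N" by (rule comm_group_tensor[OF S N])
    interpret TA: comm_group "tensor R S A" by (rule comm_group_tensor[OF S A])
    show "group (tensor R S A)" by (rule TA.is_group)
    show "(\<lambda>x\<in>carrier (tensor R S N). ?f S x \<otimes>\<^bsub>tensor R S A\<^esub> ?g S x) \<in> ab_homs (tensor R S N) (tensor R S A)"
      using ab[OF f S] ab[OF g S] by (intro ab_homsI) (auto simp: ab_homsD TA.m_ac)
    fix s n assume "s \<in> carrier S" "n \<in> carrier N"
    then show "?fg S (pure_tensor R S N s n) =
        (\<lambda>x\<in>carrier (tensor R S N). ?f S x \<otimes>\<^bsub>tensor R S A\<^esub> ?g S x) (pure_tensor R S N s n)"
      using lin_maps_closed[OF f] lin_maps_closed[OF g]
      by (simp add: quasi_coherent_map_pure[OF N A _ S] f g fg pure_tensor_closed[OF S N]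
          pure_tensor_add_right[OF S A])
  qed
  then show ?thesis
    by (auto simp: quasi_coherent_map_def intro!: restrict_ext)
qed

lemma quasi_coherent_map_zero:
  assumes N: "left_module R N" and A: "left_module R A"
  shows "quasi_coherent_map R N A (\<lambda>n\<in>carrier N. \<zero>\<^bsub>A\<^esub>) = \<one>\<^bsub>fobj (module_scheme R N) A\<^esub>"
    (is "?z = _")
proof -
  interpret A: left_module R A by fact
  note z = zero_lin_map[OF N A]
  note ab = nat_trans_ab_homs[OF quasi_coherent_map_nat_trans[OF N A z], simplified]
  have "?z S = (\<lambda>x\<in>carrier (tensor R S N). \<one>\<^bsub>tensor R S A\<^esub>)" if S: "right_module R S" for S
  proof (rule tensor_ab_homs_eqI[OF S N ab[OF S]])
    interpret T: comm_group "tensor R S N" by (rule comm_group_tensor[OF S N])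
    interpret TA: comm_group "tensor R S A" by (rule comm_group_tensor[OF S A])
    show "group (tensor R S A)" by (rule TA.is_group)
    show "(\<lambda>x\<in>carrier (tensor R S N). \<one>\<^bsub>tensor R S A\<^esub>) \<in> ab_homs (tensor R S N) (tensor R S A)"
      by (intro ab_homsI) auto
    fix s n assume s: "s \<in> carrier S" and n: "n \<in> carrier N"
    have "pure_tensor R S A s \<zero>\<^bsub>A\<^esub> \<otimes>\<^bsub>tensor R S A\<^esub> pure_tensor R S A s \<zero>\<^bsub>A\<^esub> = pure_tensor R S A s \<zero>\<^bsub>A\<^esub>"
      using pure_tensor_add_right[OF S A s, of "\<zero>\<^bsub>A\<^esub>" "\<zero>\<^bsub>A\<^esub>"] by simp
    then have "pure_tensor R S A s \<zero>\<^bsub>A\<^esub> = \<one>\<^bsub>tensor R S A\<^esub>"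
      using pure_tensor_closed[OF S A s, of "\<zero>\<^bsub>A\<^esub>"] TA.r_cancel_one' by (metis A.M.zero_closed)
    then show "?z S (pure_tensor R S N s n) =
        (\<lambda>x\<in>carrier (tensor R S N). \<one>\<^bsub>tensor R S A\<^esub>) (pure_tensor R S N s n)"
      using s n by (simp add: quasi_coherent_map_pure[OF N A z S] pure_tensor_closed[OF S N])
  qed
  then show ?thesis
    by (auto simp: quasi_coherent_map_def intro!: restrict_ext)
qed

lemma quasi_coherent_map_compose:
  fixes N A B :: "('u, 'u) module"
  assumes N: "left_module R N" and A: "left_module R A" and B: "left_module R B"
    and f: "f \<in> lin_maps R N A" and g: "g \<in> lin_maps R A B"
  shows "nat_comp (opp_ring R) (quasi_coherent R N) (quasi_coherent_map R A B g)
    (quasi_coherent_map R N A f) = quasi_coherent_map R N B (compose (carrier N) g f)"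
proof (rule quasi_coherent_nat_trans_eqI[OF N B])
  note gf = compose_lin_maps[OF N f g]
  show "quasi_coherent_map R N B (compose (carrier N) g f) \<in>
      nat_trans (opp_ring R) (quasi_coherent R N) (quasi_coherent R B)"
    by (rule quasi_coherent_map_nat_trans[OF N B gf])
  show "nat_comp (opp_ring R) (quasi_coherent R N) (quasi_coherent_map R A B g)
      (quasi_coherent_map R N A f) \<in> nat_trans (opp_ring R) (quasi_coherent R N) (quasi_coherent R B)"
  proof (rule nat_comp_nat_trans[OF quasi_coherent_map_nat_trans[OF N A f] quasi_coherent_map_nat_trans[OF A B g]])
    fix S S' :: "('u, 'u) module" and h x
    assume "right_module R S" "right_module R S'" "h \<in> lin_maps (opp_ring R) S S'"
      "x \<in> carrier (fobj (quasi_coherent R N) S)"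
    then show "fmap (quasi_coherent R N) S S' h x \<in> carrier (fobj (quasi_coherent R N) S')"
      using ab_homs_closed[OF tensor_map_ab_homs[OF _ N _ N _ id_lin_map[OF N]]] by simp
  next
    fix S :: "('u, 'u) module" and x y
    assume S: "right_module R S" and xy: "x \<in> carrier (fobj (quasi_coherent R N) S)"
      "y \<in> carrier (fobj (quasi_coherent R N) S)"
    interpret T: comm_group "tensor R S N" by (rule comm_group_tensor[OF S N])
    show "x \<otimes>\<^bsub>fobj (quasi_coherent R N) S\<^esub> y \<in> carrier (fobj (quasi_coherent R N) S)"
      using xy by simp
  qed
  fix S :: "('u, 'u) module" and s n
  assume S: "right_module R S" and "s \<in> carrier S" "n \<in> carrier N"
  then show "nat_comp (opp_ring R) (quasi_coherent R N) (quasi_coherent_map R A B g)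
      (quasi_coherent_map R N A f) S (pure_tensor R S N s n) =
      quasi_coherent_map R N B (compose (carrier N) g f) S (pure_tensor R S N s n)"
    by (simp add: nat_comp_apply pure_tensor_closed[OF S N] quasi_coherent_map_pure[OF N A f S]
        quasi_coherent_map_pure[OF A B g S] quasi_coherent_map_pure[OF N B gf S] lin_maps_closed[OF f]
        compose_eq)
qed

section \<open>Evaluation at the right module \<open>R\<close>\<close>

definition right_regular :: "'a ring \<Rightarrow> ('a, 'a) module" where
  "right_regular R = \<lparr>carrier = carrier R, monoid.mult = (\<otimes>\<^bsub>R\<^esub>), one = \<one>\<^bsub>R\<^esub>,
     ring.zero = \<zero>\<^bsub>R\<^esub>, ring.add = (\<oplus>\<^bsub>R\<^esub>), smult = (\<lambda>r x. x \<otimes>\<^bsub>R\<^esub> r)\<rparr>"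

lemma right_regular_simps [simp]:
  "carrier (right_regular R) = carrier R"
  "x \<oplus>\<^bsub>right_regular R\<^esub> y = x \<oplus>\<^bsub>R\<^esub> y"
  "\<zero>\<^bsub>right_regular R\<^esub> = \<zero>\<^bsub>R\<^esub>"
  "r \<odot>\<^bsub>right_regular R\<^esub> x = x \<otimes>\<^bsub>R\<^esub> r"
  by (simp_all add: right_regular_def)

lemma ring_opp_ring:
  assumes "ring R"
  shows "ring (opp_ring R)"
proof -
  interpret ring R by fact
  show ?thesis
    by (rule ringI, rule abelian_groupI)
       (auto simp: a_ac m_assoc l_distr r_distr intro!: monoidI bexI[where x = "\<ominus>\<^bsub>R\<^esub> _"] l_neg)
qed

lemma right_module_right_regular:
  assumes "ring R"
  shows "right_module R (right_regular R)"
proof -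
  interpret ring R by fact
  interpret opp: ring "opp_ring R" by (rule ring_opp_ring) fact
  have "abelian_group (right_regular R)"
    by (rule abelian_groupI) (auto simp: a_ac intro!: bexI[where x = "\<ominus>\<^bsub>R\<^esub> _"] l_neg)
  then show ?thesis
    by (intro left_module.intro left_module_axioms.intro opp.ring_axioms)
       (auto simp: m_assoc l_distr r_distr)
qed

lemma add_group_simps [simp]:
  "carrier (add_group M) = carrier M" "x \<otimes>\<^bsub>add_group M\<^esub> y = x \<oplus>\<^bsub>M\<^esub> y" "\<one>\<^bsub>add_group M\<^esub> = \<zero>\<^bsub>M\<^esub>"
  by (simp_all add: add_group_def)

lemma comm_group_add_group:
  assumes "left_module R M"
  shows "comm_group (add_group M)"
proof -
  interpret M: left_module R M by fact
  show ?thesis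
    by (rule comm_groupI) (auto simp: M.M.a_ac intro!: bexI[where x = "\<ominus>\<^bsub>M\<^esub> _"] M.M.l_neg)
qed

text \<open>
  The isomorphism \<open>R \<otimes>\<^sub>R A \<cong> A\<close>, given by \<open>r \<otimes> a \<mapsto> r a\<close> with inverse \<open>a \<mapsto> 1 \<otimes> a\<close>.
\<close>

lemma tensor_right_regular:
  assumes R: "ring R" and A: "left_module R A"
  obtains \<mu> where "\<mu> \<in> hom (tensor R (right_regular R) A) (add_group A)"
    and "\<And>r a. \<lbrakk>r \<in> carrier R; a \<in> carrier A\<rbrakk> \<Longrightarrow> \<mu> (pure_tensor R (right_regular R) A r a) = r \<odot>\<^bsub>A\<^esub> a"
    and "\<And>z. z \<in> carrier (tensor R (right_regular R) A) \<Longrightarrow>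
      pure_tensor R (right_regular R) A \<one>\<^bsub>R\<^esub> (\<mu> z) = z"
proof -
  interpret A: left_module R A by fact
  note RR = right_module_right_regular[OF R]
  let ?T = "tensor R (right_regular R) A" and ?p = "pure_tensor R (right_regular R) A"
  interpret T: comm_group ?T by (rule comm_group_tensor[OF RR A])
  obtain \<mu> where hom: "\<mu> \<in> hom ?T (add_group A)"
    and pure: "\<And>r a. \<lbrakk>r \<in> carrier (right_regular R); a \<in> carrier A\<rbrakk> \<Longrightarrow> \<mu> (?p r a) = r \<odot>\<^bsub>A\<^esub> a"
    by (rule tensor_universal[OF RR A comm_group_add_group[OF A], of "\<lambda>r a. r \<odot>\<^bsub>A\<^esub> a"])
       (auto simp: A.smult_closed A.smult_l_distr A.smult_r_distr A.smult_assoc)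
  have "((\<lambda>a. ?p \<one>\<^bsub>R\<^esub> a) \<circ> \<mu>) z = id z" if "z \<in> carrier ?T" for z
  proof (rule tensor_hom_eqI[OF RR A _ _ T.is_group _ that])
    have "(\<lambda>a. ?p \<one>\<^bsub>R\<^esub> a) \<in> hom (add_group A) ?T"
      by (rule homI) (auto simp: pure_tensor_closed[OF RR A] pure_tensor_add_right[OF RR A])
    then show "(\<lambda>a. ?p \<one>\<^bsub>R\<^esub> a) \<circ> \<mu> \<in> hom ?T ?T" using hom by (rule hom_compose[rotated])
    show "id \<in> hom ?T ?T" by (rule homI) auto
    fix r a assume ra: "r \<in> carrier (right_regular R)" "a \<in> carrier A"
    then have "?p \<one>\<^bsub>R\<^esub> (r \<odot>\<^bsub>A\<^esub> a) = ?p r a"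
      using pure_tensor_balanced[OF RR A, of r "\<one>\<^bsub>R\<^esub>" a] by simp
    then show "((\<lambda>a. ?p \<one>\<^bsub>R\<^esub> a) \<circ> \<mu>) (?p r a) = id (?p r a)"
      by (simp only: o_apply id_apply pure[OF ra])
  qed
  with hom pure show thesis by (intro that) auto
qed

text \<open>
  The map \<open>f\<close> is recovered from the value at the right module \<open>R\<close>, where \<open>1 \<otimes> n\<close> goes to
  \<open>1 \<otimes> f(n)\<close>.
\<close>

lemma quasi_coherent_map_inj:
  assumes N: "left_module R N" and A: "left_module R A"
  shows "inj_on (quasi_coherent_map R N A) (lin_maps R N A)"
proof (rule inj_onI)
  interpret A: left_module R A by fact
  fix f g assume f: "f \<in> lin_maps R N A" and g: "g \<in> lin_maps R N A"
    and eq: "quasi_coherent_map R N A f = quasi_coherent_map R N A g"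
  have R: "ring R" by (rule left_module.axioms(1)[OF A])
  note RR = right_module_right_regular[OF R]
  obtain \<mu> where \<mu>: "\<And>r a. \<lbrakk>r \<in> carrier R; a \<in> carrier A\<rbrakk> \<Longrightarrow>
      \<mu> (pure_tensor R (right_regular R) A r a) = r \<odot>\<^bsub>A\<^esub> a"
    using tensor_right_regular[OF R A] by metis
  have rep: "\<mu> (quasi_coherent_map R N A h (right_regular R)
      (pure_tensor R (right_regular R) N \<one>\<^bsub>R\<^esub> n)) = h n"
    if "h \<in> lin_maps R N A" "n \<in> carrier N" for h n
    using that by (simp add: quasi_coherent_map_pure[OF N A _ RR] \<mu> lin_maps_closed A.smult_one)
  show "f = g"
    using rep[OF f] rep[OF g] eq by (intro lin_maps_eqI[OF f g]) simp
qed

text \<open>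
  Write \<open>t(1 \<otimes> n) = 1 \<otimes> f(n)\<close> at the right module \<open>R\<close>. For an element \<open>s\<close> of a right module \<open>S\<close>,
  the right linear map \<open>r \<mapsto> s r\<close> from \<open>R\<close> to \<open>S\<close> sends \<open>1\<close> to \<open>s\<close>, so naturality gives
  \<open>t(s \<otimes> n) = s \<otimes> f(n)\<close>. Taking \<open>S = R\<close> in this formula yields
  \<open>1 \<otimes> f(r n) = t(1 \<otimes> r n) = t(r \<otimes> n) = r \<otimes> f(n) = 1 \<otimes> r f(n)\<close>, the linearity of \<open>f\<close>.
\<close>

lemma quasi_coherent_map_surj:
  fixes N A :: "('u, 'u) module"
  assumes N: "left_module R N" and A: "left_module R A"
    and t: "t \<in> nat_trans (opp_ring R) (quasi_coherent R N) (quasi_coherent R A)"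
  shows "t \<in> quasi_coherent_map R N A ` lin_maps R N A"
proof -
  interpret N: left_module R N by fact
  interpret A: left_module R A by fact
  have R: "ring R" by (rule left_module.axioms(1)[OF A])
  let ?R = "right_regular R"
  note RR = right_module_right_regular[OF R]
  obtain \<mu> where hom: "\<mu> \<in> hom (tensor R ?R A) (add_group A)"
    and \<mu>: "\<And>r a. \<lbrakk>r \<in> carrier R; a \<in> carrier A\<rbrakk> \<Longrightarrow> \<mu> (pure_tensor R ?R A r a) = r \<odot>\<^bsub>A\<^esub> a"
    and inv: "\<And>z. z \<in> carrier (tensor R ?R A) \<Longrightarrow> pure_tensor R ?R A \<one>\<^bsub>R\<^esub> (\<mu> z) = z"
    using tensor_right_regular[OF R A] by metis
  have tS: "t S \<in> ab_homs (tensor R S N) (tensor R S A)" if "right_module R S" for S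
    using nat_trans_ab_homs[OF t that] by simp
  define f where "f = (\<lambda>n\<in>carrier N. \<mu> (t ?R (pure_tensor R ?R N \<one>\<^bsub>R\<^esub> n)))"
  have tz: "t ?R (pure_tensor R ?R N \<one>\<^bsub>R\<^esub> n) \<in> carrier (tensor R ?R A)" if "n \<in> carrier N" for n
    using that ab_homs_closed[OF tS[OF RR]] pure_tensor_closed[OF RR N] by simp
  have fA: "f n \<in> carrier A" if "n \<in> carrier N" for n
    using that tz hom_in_carrier[OF hom] by (simp add: f_def)
  have t1: "t ?R (pure_tensor R ?R N \<one>\<^bsub>R\<^esub> n) = pure_tensor R ?R A \<one>\<^bsub>R\<^esub> (f n)" if "n \<in> carrier N" for n
    using that inv[OF tz] by (simp add: f_def)
  have tpure: "t S (pure_tensor R S N s n) = pure_tensor R S A s (f n)"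
    if S: "right_module R S" and s: "s \<in> carrier S" and n: "n \<in> carrier N" for S s n
  proof -
    interpret S: left_module "opp_ring R" S by fact
    define l where "l = (\<lambda>r\<in>carrier R. r \<odot>\<^bsub>S\<^esub> s)"
    have l: "l \<in> lin_maps (opp_ring R) ?R S"
      using s S.smult_closed S.smult_l_distr S.smult_assoc
      by (intro lin_mapsI) (auto simp: l_def)
    have l1: "l \<one>\<^bsub>R\<^esub> = s" using s S.smult_one by (simp add: l_def)
    have "t S (pure_tensor R S N s n) =
        t S (fmap (quasi_coherent R N) ?R S l (pure_tensor R ?R N \<one>\<^bsub>R\<^esub> n))"
      using n l1 by (simp add: tensor_map_pure[OF RR N S N l id_lin_map[OF N]])
    also have "\<dots> = fmap (quasi_coherent R A) ?R S l (t ?R (pure_tensor R ?R N \<one>\<^bsub>R\<^esub> n))"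
      using nat_trans_natural[OF t RR S l] n pure_tensor_closed[OF RR N] by simp
    also have "\<dots> = pure_tensor R S A s (f n)"
      using n l1 fA by (simp add: t1 tensor_map_pure[OF RR A S A l id_lin_map[OF A]])
    finally show ?thesis .
  qed
  have f: "f \<in> lin_maps R N A"
  proof (rule lin_mapsI)
    fix n m assume "n \<in> carrier N" "m \<in> carrier N"
    then show "f (n \<oplus>\<^bsub>N\<^esub> m) = f n \<oplus>\<^bsub>A\<^esub> f m"
      using tz hom_mult[OF hom]
      by (simp add: f_def pure_tensor_add_right[OF RR N] pure_tensor_closed[OF RR N]
          ab_homs_mult[OF tS[OF RR]])
  next
    fix r n assume rn: "r \<in> carrier R" "n \<in> carrier N"
    have "f (r \<odot>\<^bsub>N\<^esub> n) = \<mu> (t ?R (pure_tensor R ?R N r n))"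
      using rn N.smult_closed pure_tensor_balanced[OF RR N, of r "\<one>\<^bsub>R\<^esub>" n] by (simp add: f_def)
    also have "\<dots> = r \<odot>\<^bsub>A\<^esub> f n"
      using rn fA by (simp add: tpure[OF RR] \<mu>)
    finally show "f (r \<odot>\<^bsub>N\<^esub> n) = r \<odot>\<^bsub>A\<^esub> f n" .
  qed (auto simp: fA, simp add: f_def)
  have "t = quasi_coherent_map R N A f"
    by (rule quasi_coherent_nat_trans_eqI[OF N A t quasi_coherent_map_nat_trans[OF N A f]])
       (simp add: tpure quasi_coherent_map_pure[OF N A f])
  with f show ?thesis by blast
qed

section \<open>The isomorphism with \<open>Hom\<^sub>R(N, -)\<close>\<close>

lemma module_scheme_map_quasi_coherent_map:
  fixes N A B :: "('u, 'u) module"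
  assumes "left_module R N" "left_module R A" "left_module R B"
    and "f \<in> lin_maps R N A" "g \<in> lin_maps R A B"
  shows "fmap (module_scheme R N) A B g (quasi_coherent_map R N A f) =
    quasi_coherent_map R N B (fmap (hom_functor R N) A B g f)"
  using assms by (simp add: quasi_coherent_map_nat_trans quasi_coherent_map_compose)

lemma bij_betw_quasi_coherent_map:
  fixes N A :: "('u, 'u) module"
  assumes N: "left_module R N" and A: "left_module R A"
  shows "bij_betw (quasi_coherent_map R N A) (carrier (fobj (hom_functor R N) A))
    (carrier (fobj (module_scheme R N) A))"
  using quasi_coherent_map_inj[OF N A] quasi_coherent_map_surj[OF N A]
    quasi_coherent_map_nat_trans[OF N A] by (auto simp: bij_betw_def)

lemma quasi_coherent_map_hom:
  assumes N: "left_module R N" and A: "left_module R A"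
  shows "quasi_coherent_map R N A \<in> hom (fobj (hom_functor R N) A) (fobj (module_scheme R N) A)"
  by (rule homI)
     (simp_all add: quasi_coherent_map_nat_trans[OF N A] quasi_coherent_map_add[OF N A] del: module_scheme_simps(2))

lemma additive_module_scheme:
  fixes N :: "('u, 'u) module"
  assumes N: "left_module R N"
  shows "additive_functor R (module_scheme R N)"
proof (rule additive_functor_surj_image[OF additive_hom_functor[OF N],
      where \<phi> = "quasi_coherent_map R N"])
  fix A :: "('u, 'u) module" assume A: "left_module R A"
  show "quasi_coherent_map R N A \<in> hom (fobj (hom_functor R N) A) (fobj (module_scheme R N) A)"
    by (rule quasi_coherent_map_hom[OF N A])
  show "quasi_coherent_map R N A ` carrier (fobj (hom_functor R N) A) = carrier (fobj (module_scheme R N) A)"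
    by (rule bij_betw_imp_surj_on[OF bij_betw_quasi_coherent_map[OF N A]])
  show "quasi_coherent_map R N A \<one>\<^bsub>fobj (hom_functor R N) A\<^esub> = \<one>\<^bsub>fobj (module_scheme R N) A\<^esub>"
    using quasi_coherent_map_zero[OF N A] by simp
next
  fix A B :: "('u, 'u) module" and g f
  assume "left_module R A" "left_module R B" "g \<in> lin_maps R A B"
    and "f \<in> carrier (fobj (hom_functor R N) A)"
  then show "fmap (module_scheme R N) A B g (quasi_coherent_map R N A f) =
      quasi_coherent_map R N B (fmap (hom_functor R N) A B g f)"
    by (intro module_scheme_map_quasi_coherent_map[OF N]) auto
qed simp

text \<open>
  The maps \<^const>\<open>quasi_coherent_map\<close> assembled into a natural transformation; the restrictions
  make its components extensional.
\<close>

definition hom_to_module_scheme :: "'u ring \<Rightarrow> ('u, 'u) module \<Rightarrow> ('u, 'u) module \<Rightarrow> ('u \<Rightarrow> 'u) \<Rightarrow>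
    ('u, 'u) module \<Rightarrow> (('u \<times> 'u) \<Rightarrow>\<^sub>0 int) set \<Rightarrow> (('u \<times> 'u) \<Rightarrow>\<^sub>0 int) set" where
  "hom_to_module_scheme R N =
     (\<lambda>A\<in>{A. left_module R A}. \<lambda>f\<in>lin_maps R N A. quasi_coherent_map R N A f)"

lemma hom_to_module_scheme_apply:
  "\<lbrakk>left_module R A; f \<in> carrier (fobj (hom_functor R N) A)\<rbrakk> \<Longrightarrow>
    hom_to_module_scheme R N A f = quasi_coherent_map R N A f"
  by (simp add: hom_to_module_scheme_def)

lemma hom_to_module_scheme_nat_trans:
  fixes N :: "('u, 'u) module"
  assumes N: "left_module R N"
  shows "hom_to_module_scheme R N \<in> nat_trans R (hom_functor R N) (module_scheme R N)"
proof (rule nat_transI)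
  let ?h = "hom_functor R N" and ?P = "module_scheme R N"
  fix A :: "('u, 'u) module" assume A: "left_module R A"
  show "hom_to_module_scheme R N A \<in> ab_homs (fobj ?h A) (fobj ?P A)"
  proof (rule ab_homsI)
    fix f g assume fg: "f \<in> carrier (fobj ?h A)" "g \<in> carrier (fobj ?h A)"
    show "hom_to_module_scheme R N A f \<in> carrier (fobj ?P A)"
      using hom_in_carrier[OF quasi_coherent_map_hom[OF N A] fg(1)]
      by (simp only: hom_to_module_scheme_apply[OF A fg(1)])
    show "hom_to_module_scheme R N A (f \<otimes>\<^bsub>fobj ?h A\<^esub> g) =
        hom_to_module_scheme R N A f \<otimes>\<^bsub>fobj ?P A\<^esub> hom_to_module_scheme R N A g"
      using hom_mult[OF quasi_coherent_map_hom[OF N A] fg]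
        functor_mult_closed[OF additive_hom_functor[OF N] A fg] fg
      by (simp only: hom_to_module_scheme_apply[OF A])
  qed (use A in \<open>simp add: hom_to_module_scheme_def\<close>)
  fix B :: "('u, 'u) module" and g f
  assume B: "left_module R B" and g: "g \<in> lin_maps R A B" and f: "f \<in> carrier (fobj ?h A)"
  show "fmap ?P A B g (hom_to_module_scheme R N A f) = hom_to_module_scheme R N B (fmap ?h A B g f)"
    using module_scheme_map_quasi_coherent_map[OF N A B _ g, of f] f
      functor_map_closed[OF additive_hom_functor[OF N] A B g f]
    by (simp only: hom_to_module_scheme_apply[OF A f] hom_to_module_scheme_apply[OF B]) simp
qed (simp add: hom_to_module_scheme_def)

theorem proposition2p9:
  fixes R :: "'u ring" and N :: "('u, 'u) module"
  assumes "ring R" and "left_module R N"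
  shows "projective_functor TYPE('v) TYPE('w) R (module_scheme R N) \<and>
         left_exact_functor R (module_scheme R N)"
proof
  note N = assms(2)
  note h = additive_hom_functor[OF N] and P = additive_module_scheme[OF N]
    and \<phi> = hom_to_module_scheme_nat_trans[OF N]
  have bij: "bij_betw (hom_to_module_scheme R N A) (carrier (fobj (hom_functor R N) A))
      (carrier (fobj (module_scheme R N) A))" if A: "left_module R A" for A
    using bij_betw_quasi_coherent_map[OF N A] hom_to_module_scheme_apply[OF A]
    by (simp cong: bij_betw_cong del: hom_functor_simps module_scheme_simps)
  show "left_exact_functor R (module_scheme R N)"
    by (rule left_exact_functor_natural_iso[OF left_exact_hom_functor[OF N] P \<phi> bij])
  obtain \<psi> where "\<psi> \<in> nat_trans R (module_scheme R N) (hom_functor R N)"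
    and "\<And>A y. \<lbrakk>left_module R A; y \<in> carrier (fobj (module_scheme R N) A)\<rbrakk> \<Longrightarrow>
      hom_to_module_scheme R N A (\<psi> A y) = y"
    using nat_trans_inverse[OF h P \<phi> bij] by metis
  then show "projective_functor TYPE('v) TYPE('w) R (module_scheme R N)"
    by (rule projective_functor_retract[OF projective_hom_functor[OF N] P _ \<phi>])
qed

end
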